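(* Let $P$ be a convex Euclidean $n$-gon. Let $q^-$ and $q^+$ be two boundary quadrilaterals of $P$ that share exactly three vertices. For any placement of the puncture $p$ in the interior of $q^-\cap q^+$, the resulting punctured polygon $P^\star$ is such that the natural embedding $\mathcal{A}_n\hookrightarrow\overline{\mathcal{F}}(P^\star)$ is strongly convex.
   Context: A boundary quadrilateral of a convex polygon $P$ is a quadrilateral, with vertices among those of $P$, that shares at least three of its edges with $P$. Let $P$ be a convex Euclidean $n$-gon, and let $P^\star$ denote $P$ together with a chosen point $p$ in its interior, called the puncture. The marked points of $P$ are its vertices; the marked points of $P^\star$ are the vertices of $P$ and $p$. For each of $P$ and $P^\star$, an arc is a Euclidean line segment joining two distinct marked points with no marked point in its interior; two arcs are non-crossing if their interiors are disjoint; a triangulation is a maximal set of pairwise non-crossing arcs (including the boundary edges of $P$). The flip-graphs $\mathcal{F}(P)$ and $\mathcal{F}(P^\star)$ have as vertices the triangulations of $P$, respectively of $P^\star$, with two triangulations joined by an edge when they differ by a single arc. Since $P$ is convex, $\mathcal{F}(P)$ is isomorphic to $\mathcal{A}_n$, the graph ($1$-skeleton) of the associahedron, i.e. the flip-graph of triangulations of a convex $n$-gon. Flipping the puncture into a triangulation $T$ of $P$ means the following. If $p$ lies in the interior of a triangle $t$ of $T$, add the three segments joining $p$ to the vertices of $t$. If $p$ lies on an edge $\varepsilon$ of $T$, remove $\varepsilon$ and add the four segments joining $p$ to the vertices of the quadrilateral formed by the two triangles of $T$ incident to $\varepsilon$. In both cases the result is a triangulation of $P^\star$. The graph $\overline{\mathcal{F}}(P^\star)$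 is obtained from the disjoint union of $\mathcal{F}(P)$ and $\mathcal{F}(P^\star)$ by adding an edge between a triangulation $T$ of $P$ and a triangulation $T'$ of $P^\star$ whenever $T'$ is obtained by flipping the puncture into $T$. The natural embedding $\mathcal{A}_n\hookrightarrow\overline{\mathcal{F}}(P^\star)$ identifies $\mathcal{A}_n$ with the subgraph $\mathcal{F}(P)$. A subgraph $X$ of a graph $Y$ is strongly convex in $Y$ if every geodesic (shortest path) of $Y$ between any two vertices of $X$ lies entirely in $X$. An embedding of graphs is strongly convex if its image is a strongly convex subgraph. *)

theory Defs
  imports "HOL-Analysis.Analysis" "Graph_Theory.Graph_Theory"
begin

section \<open>Convex polygons in the Euclidean plane\<close>

definition polygon_vertices :: "(real^2) set \<Rightarrow> (real^2) set" where
  "polygon_vertices P = {v. v extreme_point_of P}"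

text \<open>The polygon is the filled region. No two of its edges are collinear, since the vertices are
  the extreme points; \<open>n \<ge> 3\<close> follows from the dimension.\<close>

definition convex_polygon :: "nat \<Rightarrow> (real^2) set \<Rightarrow> bool" where
  "convex_polygon n P \<longleftrightarrow> polytope P \<and> aff_dim P = 2 \<and> card (polygon_vertices P) = n"

text \<open>It is no restriction to take the quadrilateral convex: three common edges with \<open>P\<close> force its
  vertices to be visited in the cyclic order of \<open>P\<close>.\<close>

definition boundary_quadrilateral :: "(real^2) set \<Rightarrow> (real^2) set \<Rightarrow> bool" where
  "boundary_quadrilateral Q P \<longleftrightarrow>
     convex_polygon 4 Q \<and> polygon_vertices Q \<subseteq> polygon_vertices P \<and>
     card {e. e edge_of Q \<and> e edge_of P} \<ge> 3"

section \<open>Triangulations and flip-graphs\<close>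

text \<open>Everything here depends only on the set \<open>M\<close> of marked points. For a polygon \<open>P\<close> this is
  \<open>polygon_vertices P\<close>; for \<open>P\<close> punctured at \<open>p\<close> it is \<open>insert p (polygon_vertices P)\<close>.
  An arc is the closed segment itself (a point set), so a triangulation is a set of point sets.\<close>

definition segment_arcs :: "(real^2) set \<Rightarrow> (real^2) set set" where
  "segment_arcs M =
     {closed_segment a b | a b. a \<in> M \<and> b \<in> M \<and> a \<noteq> b \<and> open_segment a b \<inter> M = {}}"

text \<open>The interior of an arc is its relative interior, i.e. the open segment.\<close>

definition non_crossing :: "(real^2) set set \<Rightarrow> bool" where
  "non_crossing T \<longleftrightarrow> pairwise (\<lambda>s t. rel_interior s \<inter> rel_interior t = {}) T"

definition triangulations :: "(real^2) set \<Rightarrow> (real^2) set set set" where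
  "triangulations M =
     {T. T \<subseteq> segment_arcs M \<and> non_crossing T \<and>
         (\<forall>T'. T \<subseteq> T' \<and> T' \<subseteq> segment_arcs M \<and> non_crossing T' \<longrightarrow> T' = T)}"

text \<open>Undirected simple graphs are represented by symmetric loop-free digraphs.\<close>

definition flip_graph :: "(real^2) set \<Rightarrow> (real^2) set set pair_pre_digraph" where
  "flip_graph M =
     \<lparr> pverts = triangulations M,
       parcs = {(T, T'). T \<in> triangulations M \<and> T' \<in> triangulations M \<and>
                         card (T - T') = 1 \<and> card (T' - T) = 1} \<rparr>"

section \<open>Flipping the puncture into a triangulation\<close>

text \<open>In a triangulation of a convex polygon, three distinct vertices that are pairwise joined by
  arcs always bound a triangle of the triangulation, because no vertex lies inside.\<close>

definition is_triangle_of :: "(real^2) set set \<Rightarrow> real^2 \<Rightarrow> real^2 \<Rightarrow> real^2 \<Rightarrow> bool" where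
  "is_triangle_of T a b c \<longleftrightarrow> distinct [a, b, c] \<and>
     closed_segment a b \<in> T \<and> closed_segment b c \<in> T \<and> closed_segment c a \<in> T"

definition puncture_flip :: "real^2 \<Rightarrow> (real^2) set set \<Rightarrow> (real^2) set set \<Rightarrow> bool" where
  "puncture_flip p T T' \<longleftrightarrow>
     (\<exists>a b c. is_triangle_of T a b c \<and> p \<in> interior (convex hull {a, b, c}) \<and>
        T' = T \<union> closed_segment p ` {a, b, c}) \<or>
     (\<exists>a b c d. is_triangle_of T a b c \<and> is_triangle_of T a b d \<and> c \<noteq> d \<and>
        p \<in> closed_segment a b \<and>
        T' = (T - {closed_segment a b}) \<union> closed_segment p ` {a, b, c, d})"

text \<open>The two summands of the vertex type realise the disjoint union of the flip-graph of \<open>P\<close>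
  (left) and that of \<open>P\<close> punctured at \<open>p\<close> (right).\<close>

definition extended_flip_graph ::
  "(real^2) set \<Rightarrow> real^2 \<Rightarrow> ((real^2) set set + (real^2) set set) pair_pre_digraph" where
  "extended_flip_graph P p =
     (let F = flip_graph (polygon_vertices P);
          F' = flip_graph (insert p (polygon_vertices P));
          E = {(Inl T, Inr T') | T T'. T \<in> pverts F \<and> T' \<in> pverts F' \<and> puncture_flip p T T'}
      in \<lparr> pverts = Inl ` pverts F \<union> Inr ` pverts F',
           parcs = map_prod Inl Inl ` parcs F \<union> map_prod Inr Inr ` parcs F' \<union> E \<union> E\<inverse> \<rparr>)"

section \<open>Strong convexity\<close>

definition geodesic :: "'a pair_pre_digraph \<Rightarrow> 'a \<Rightarrow> 'a \<Rightarrow> 'a vwalk \<Rightarrow> bool" where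
  "geodesic Y u v w \<longleftrightarrow>
     vwalk w (with_proj Y) \<and> hd w = u \<and> last w = v \<and>
     (\<forall>w'. vwalk w' (with_proj Y) \<and> hd w' = u \<and> last w' = v \<longrightarrow> vwalk_length w \<le> vwalk_length w')"

text \<open>A walk lies in \<open>X\<close> when both its vertices and its edges do, i.e. when it is a walk of \<open>X\<close>.\<close>

definition strongly_convex :: "'a pair_pre_digraph \<Rightarrow> 'a pair_pre_digraph \<Rightarrow> bool" where
  "strongly_convex X Y \<longleftrightarrow> subgraph (with_proj X) (with_proj Y) \<and>
     (\<forall>u \<in> pverts X. \<forall>v \<in> pverts X. \<forall>w. geodesic Y u v w \<longrightarrow> vwalk w (with_proj X))"

definition image_graph :: "('a \<Rightarrow> 'b) \<Rightarrow> 'a pair_pre_digraph \<Rightarrow> 'b pair_pre_digraph" where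
  "image_graph f X = \<lparr> pverts = f ` pverts X, parcs = map_prod f f ` parcs X \<rparr>"

text \<open>That \<open>f\<close> maps edges of \<open>X\<close> to edges of \<open>Y\<close> is part of the image being a subgraph.\<close>

definition strongly_convex_embedding ::
  "('a \<Rightarrow> 'b) \<Rightarrow> 'a pair_pre_digraph \<Rightarrow> 'b pair_pre_digraph \<Rightarrow> bool" where
  "strongly_convex_embedding f X Y \<longleftrightarrow>
     inj_on f (pverts X) \<and> strongly_convex (image_graph f X) Y"

end

theory Submission
  imports Defs
begin

text \<open>
  Number the vertices counterclockwise from \<open>0\<close> to \<open>n - 1\<close>, starting at the middle one of the three
  shared vertices. The position of the puncture \<open>p\<close> forces it to lie on the same side as vertex \<open>0\<close>
  of every chord not incident to \<open>0\<close>, with the possible exception of the chord cutting off the ear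
  at \<open>0\<close>. (For \<open>n = 5\<close> the shared vertices need not be consecutive, but then every interior point
  has this property for a suitable choice of vertex \<open>0\<close>.) Contracting \<open>p\<close> to vertex \<open>0\<close> therefore
  maps triangulations of the punctured polygon to triangulations of \<open>P\<close>; it moves at most one arc
  when one arc is moved, so it does not increase lengths of paths. A path that leaves the flip-graph
  of \<open>P\<close> is thereby shortened, unless it leaves and returns through triangulations containing the
  ear chord at \<open>0\<close>. In that case the part in between is shortened by contracting \<open>p\<close> to
  vertex \<open>0\<close> and then vertex \<open>0\<close> to vertex \<open>1\<close>, reinserting the ear afterwards.
\<close>

section \<open>Triangulations of a convex polygon as chord relations\<close>

text \<open>The side condition is what makes contraction harmless: a spoke to vertex s turns into
  the chord (0, s), which crosses a chord avoiding vertex 0 exactly when the spoke did, provided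
  that chord does not separate the puncture from 0. The position of the puncture leaves the ear
  chord as the only possible separator. There the obstruction is real: if the puncture is inserted
  behind or on the ear chord, with m the third vertex of the triangle behind it, contraction can
  return the triangulation with (1, n - 1) flipped to (0, m). The exit edge is then mapped to a flip
  rather than collapsed, and the projected walk gains nothing from it. The second contraction undoes
  precisely this flip, since (0, m) goes to (1, m) and the ear returns. It cannot be applied to the
  whole walk, because it may move end points that lack the ear chord. The combinatorics uses only
  the order of the indices and the signs of \<open>\<sigma> i j\<close>, so a puncture lying on a
  chord appears simply as the sign 0.\<close>

definition crosses :: "nat \<Rightarrow> nat \<Rightarrow> nat \<Rightarrow> nat \<Rightarrow> bool" where
  "crosses i j k l \<longleftrightarrow> i < k \<and> k < j \<and> j < l \<or> k < i \<and> i < l \<and> l < j"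

text \<open>
  The sign of \<open>\<sigma> i j\<close> tells on which side of the chord from \<open>i\<close> to \<open>j\<close> the puncture lies: positive
  means the side not containing the vertices strictly between \<open>i\<close> and \<open>j\<close>. If it is \<open>0\<close>, the puncture
  is on the chord, which is then not an arc.
\<close>

definition spoke_crosses :: "(nat \<Rightarrow> nat \<Rightarrow> real) \<Rightarrow> nat \<Rightarrow> nat \<Rightarrow> nat \<Rightarrow> bool" where
  "spoke_crosses \<sigma> s i j \<longleftrightarrow> \<sigma> i j > 0 \<and> i < s \<and> s < j \<or> \<sigma> i j < 0 \<and> (s < i \<or> j < s)"

text \<open>Maximality is stated locally, as the presence of every chord that crosses none in
  \<open>E\<close>. Pairs are kept increasing, as \<open>crosses\<close> presupposes.\<close>

definition chord_triangulation :: "nat \<Rightarrow> (nat \<Rightarrow> nat \<Rightarrow> bool) \<Rightarrow> bool" where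
  "chord_triangulation n E \<longleftrightarrow>
     (\<forall>i j. E i j \<longrightarrow> i < j \<and> j < n) \<and>
     (\<forall>i j k l. E i j \<longrightarrow> E k l \<longrightarrow> \<not> crosses i j k l) \<and>
     (\<forall>i j. i < j \<longrightarrow> j < n \<longrightarrow> (\<forall>k l. E k l \<longrightarrow> \<not> crosses i j k l) \<longrightarrow> E i j)"

text \<open>\<open>Q\<close> is the set of ends of the arcs at the puncture. Two such arcs share
  only the puncture, so no condition relates them; a chord through the puncture is not an
  arc.\<close>

definition spoked_triangulation ::
    "nat \<Rightarrow> (nat \<Rightarrow> nat \<Rightarrow> real) \<Rightarrow> (nat \<Rightarrow> nat \<Rightarrow> bool) \<Rightarrow> (nat \<Rightarrow> bool) \<Rightarrow> bool" where
  "spoked_triangulation n \<sigma> E Q \<longleftrightarrow>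
     (\<forall>i j. E i j \<longrightarrow> i < j \<and> j < n \<and> \<sigma> i j \<noteq> 0) \<and>
     (\<forall>s. Q s \<longrightarrow> s < n) \<and>
     (\<forall>i j k l. E i j \<longrightarrow> E k l \<longrightarrow> \<not> crosses i j k l) \<and>
     (\<forall>i j s. E i j \<longrightarrow> Q s \<longrightarrow> \<not> spoke_crosses \<sigma> s i j) \<and>
     (\<forall>i j. i < j \<longrightarrow> j < n \<longrightarrow> \<sigma> i j \<noteq> 0 \<longrightarrow> (\<forall>k l. E k l \<longrightarrow> \<not> crosses i j k l) \<longrightarrow>
        (\<forall>s. Q s \<longrightarrow> \<not> spoke_crosses \<sigma> s i j) \<longrightarrow> E i j) \<and>
     (\<forall>s<n. (\<forall>i j. E i j \<longrightarrow> \<not> spoke_crosses \<sigma> s i j) \<longrightarrow> Q s)"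

text \<open>Vertex \<open>0\<close> is contracted to vertex \<open>1\<close> and then put back as an ear.\<close>

definition contract_chords :: "nat \<Rightarrow> (nat \<Rightarrow> nat \<Rightarrow> bool) \<Rightarrow> nat \<Rightarrow> nat \<Rightarrow> bool" where
  "contract_chords n E i j \<longleftrightarrow> i = 0 \<and> (j = 1 \<or> j = n - 1) \<or> i > 0 \<and> i < j \<and> (E i j \<or> i = 1 \<and> E 0 j)"

text \<open>
  The puncture is contracted to vertex \<open>0\<close>. The ear chord \<open>(1, n - 1)\<close> is in the way when it separates
  the two, so it is dropped.
\<close>

definition contract_spokes ::
    "nat \<Rightarrow> (nat \<Rightarrow> nat \<Rightarrow> real) \<Rightarrow> (nat \<Rightarrow> nat \<Rightarrow> bool) \<Rightarrow> (nat \<Rightarrow> bool) \<Rightarrow> nat \<Rightarrow> nat \<Rightarrow> bool" where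
  "contract_spokes n \<sigma> E Q i j \<longleftrightarrow> i < j \<and>
     (if i = 0 then E 0 j \<or> Q j else E i j \<and> ((i, j) = (1, n - 1) \<longrightarrow> \<sigma> 1 (n - 1) > 0))"

text \<open>Together with its dual, it brackets a vertex \<open>v\<close> between consecutive
  neighbours of vertex 0 and so finds the triangle at 0 facing \<open>v\<close>.\<close>

lemma greatest_neighbour:
  fixes v :: nat
  assumes "P a" "a \<le> v"
  obtains z where "P z" "a \<le> z" "z \<le> v" "\<And>y. P y \<Longrightarrow> y \<le> v \<Longrightarrow> y \<le> z"
proof
  let ?z = "GREATEST y. P y \<and> y \<le> v"
  have 1: "P ?z \<and> ?z \<le> v" by (rule GreatestI_nat[where k=a and b=v]) (use assms in auto)
  have 2: "y \<le> ?z" if "P y" "y \<le> v" for y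
    by (rule Greatest_le_nat[where b=v]) (use that in auto)
  show "P ?z" "?z \<le> v" using 1 by auto
  show "a \<le> ?z" using 2 assms by blast
  show "\<And>y. P y \<Longrightarrow> y \<le> v \<Longrightarrow> y \<le> ?z" using 2 by blast
qed

lemma least_neighbour:
  fixes v :: nat
  assumes "P b" "v \<le> b"
  obtains z where "P z" "v \<le> z" "z \<le> b" "\<And>y. P y \<Longrightarrow> v \<le> y \<Longrightarrow> z \<le> y"
proof
  let ?z = "LEAST y. P y \<and> v \<le> y"
  have 1: "P ?z \<and> v \<le> ?z" by (rule LeastI[where k=b]) (use assms in auto)
  have 2: "?z \<le> y" if "P y" "v \<le> y" for y
    by (rule Least_le) (use that in auto)
  show "P ?z" "v \<le> ?z" using 1 by auto
  show "?z \<le> b" using 2 assms by blast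
  show "\<And>y. P y \<Longrightarrow> v \<le> y \<Longrightarrow> ?z \<le> y" using 2 by blast
qed

text \<open>In the triangle on 0, \<open>z\<close> and \<open>w\<close>, a chord entering through
  the side opposite 0 either ends at 0, which the gap rules out, or leaves through another
  side.\<close>

lemma no_crossing_between_neighbours:
  assumes nc: "\<And>i j k l. E i j \<Longrightarrow> E k l \<Longrightarrow> \<not> crosses i j k l"
    and lt: "\<And>i j. E i j \<Longrightarrow> i < j"
    and z: "E 0 z" and w: "E 0 w" and gap: "\<And>y. E 0 y \<Longrightarrow> z < y \<Longrightarrow> y < w \<Longrightarrow> False"
    and kl: "E k l"
  shows "\<not> crosses z w k l"
proof
  assume c: "crosses z w k l"
  have "0 < z" using lt z by blast
  show False
  proof (cases "k = 0")
    case True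
    then show ?thesis using c gap[of l] kl \<open>0 < z\<close> by (auto simp: crosses_def)
  next
    case False
    then show ?thesis using c nc[OF z kl] nc[OF w kl] by (auto simp: crosses_def)
  qed
qed

section \<open>Boundary edges, the ear at vertex 0, and its contraction\<close>

lemma chord_triangulation_maximal:
  assumes E: "chord_triangulation n E" and F: "chord_triangulation n F"
    and le: "\<And>i j. E i j \<Longrightarrow> F i j"
  shows "E = F"
proof -
  have "E i j" if "F i j" for i j
    using that E F le unfolding chord_triangulation_def by meson
  then show ?thesis using le by blast
qed

lemma chord_triangulation_outer:
  assumes "chord_triangulation n E" "n \<ge> 3"
  shows "E 0 1" "E 0 (n - 1)"
proof -
  have lt: "E i j \<Longrightarrow> i < j \<and> j < n"
    and mx: "i < j \<Longrightarrow> j < n \<Longrightarrow> (\<And>k l. E k l \<Longrightarrow> \<not> crosses i j k l) \<Longrightarrow> E i j" for i j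
    using assms(1) unfolding chord_triangulation_def by meson+
  show "E 0 1" by (rule mx) (use assms(2) lt in \<open>auto simp: crosses_def\<close>)
  show "E 0 (n - 1)" by (rule mx) (use assms(2) lt in \<open>force simp: crosses_def\<close>)+
qed

lemma chord_triangulation_ear:
  assumes E: "chord_triangulation n E" and ear: "E 1 (n - 1)" and 0: "E 0 j"
  shows "j = 1 \<or> j = n - 1"
proof -
  have "0 < j \<and> j < n" "\<not> crosses 0 j 1 (n - 1)"
    using E ear 0 unfolding chord_triangulation_def by meson+
  then show ?thesis by (auto simp: crosses_def)
qed

text \<open>Moving the end 0 of a chord to 1 creates no crossing, since a chord avoiding 0 that
  crosses (1, j) crosses (0, j) too. Maximality is delicate only for chords at vertex 1, where two
  stars are merged.\<close>

lemma chord_triangulation_contract_chords: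
  assumes n: "n \<ge> 3" and E: "chord_triangulation n E"
  shows "chord_triangulation n (contract_chords n E)"
proof -
  let ?R = "contract_chords n E"
  have lt: "E i j \<Longrightarrow> i < j \<and> j < n"
    and nc: "E i j \<Longrightarrow> E k l \<Longrightarrow> \<not> crosses i j k l" 
    and mx: "i < j \<Longrightarrow> j < n \<Longrightarrow> (\<And>k l. E k l \<Longrightarrow> \<not> crosses i j k l) \<Longrightarrow> E i j" for i j k l
    using E unfolding chord_triangulation_def by meson+
  note E01 = chord_triangulation_outer(1)[OF E n] and E0n = chord_triangulation_outer(2)[OF E n]
  have lt': "?R i j \<Longrightarrow> i < j \<and> j < n" for i j
    using n lt by (auto simp: contract_chords_def)
  have nc1: "\<not> crosses 1 j k l" if "E 0 j" "E k l" "k > 0" for j k l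
    using nc[OF that(1,2)] that(3) by (auto simp: crosses_def)
  have sym: "crosses i j k l = crosses k l i j" for i j k l by (auto simp: crosses_def)
  have nc': "\<not> crosses i j k l" if a: "?R i j" and b: "?R k l" for i j k l
  proof -
    consider "i = 0" "j = 1 \<or> j = n - 1" | "k = 0" "l = 1 \<or> l = n - 1"
      | "E i j" "E k l" | "i = 1" "E 0 j" "E k l" "k > 0" | "k = 1" "E 0 l" "E i j" "i > 0" | "i = 1" "k = 1"
      using a b by (auto simp: contract_chords_def)
    then show ?thesis
    proof cases
      case 1 then show ?thesis using lt'[OF b] by (auto simp: crosses_def)
    next
      case 2 then show ?thesis using lt'[OF a] by (auto simp: crosses_def)
    next
      case 3 then show ?thesis using nc by blast
    next
      case 4 then show ?thesis using nc1 by simp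
    next
      case 5 then show ?thesis using nc1 sym by simp
    qed (auto simp: crosses_def)
  qed
  have mx': "?R u v" if uv: "u < v" "v < n" and c: "\<And>k l. ?R k l \<Longrightarrow> \<not> crosses u v k l" for u v
  proof -
    \<comment> \<open>The image of the boundary edge (0, n - 1); it blocks every chord at 0 except
      the two boundary edges.\<close>
    have "?R 1 (n-1)" using E0n n by (auto simp: contract_chords_def)
    note c1 = c[OF this]
    consider "u = 0" | "u = 1" | "u > 1" by linarith
    then show ?thesis
    proof cases
      case 1
      then have "v = 1 \<or> v = n - 1" using c1 uv by (auto simp: crosses_def)
      then show ?thesis using 1 by (auto simp: contract_chords_def)
    next
      case 2
      show ?thesis
      proof (rule ccontr)
        assume "\<not> ?R u v"
        then have nE: "\<not> E 0 v" "\<not> E 1 v" using 2 uv by (auto simp: contract_chords_def)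
        \<comment> \<open>If \<open>v\<close> is joined to neither 0 nor 1, the triangle of
          \<open>E\<close> at 0 facing \<open>v\<close> has a side (z, w) that survives the
          contraction and must not cross (1, v). This forces \<open>z = 1\<close>.\<close>
        obtain z where z: "E 0 z" "1 \<le> z" "z \<le> v" "\<And>y. E 0 y \<Longrightarrow> y \<le> v \<Longrightarrow> y \<le> z"
          using greatest_neighbour[of "E 0" 1 v] E01 uv by auto
        have "v \<le> n - 1" using uv by linarith
        then obtain w where w: "E 0 w" "v \<le> w" "w \<le> n - 1" "\<And>y. E 0 y \<Longrightarrow> v \<le> y \<Longrightarrow> w \<le> y"
          using least_neighbour[of "E 0" "n - 1" v, OF E0n] by blast
        have zv: "z < v" "v < w" using z w nE by (metis le_neq_implies_less)+
        have "E z w"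
        proof (rule mx)
          fix k l assume "E k l"
          show "\<not> crosses z w k l"
          proof (rule no_crossing_between_neighbours[where E=E])
            fix y assume "E 0 y" "z < y" "y < w"
            then show False using z(4)[of y] w(4)[of y] by linarith
          qed (use nc lt z w \<open>E k l\<close> in auto)
        qed (use zv w n in auto)
        then have R: "?R z w" using z zv by (auto simp: contract_chords_def)
        have "z = 1" using c[OF R] zv z(2) 2 by (auto simp: crosses_def)
        \<comment> \<open>No neighbour of 0 lies strictly between 1 and \<open>v\<close>, so the
          chords at 0 do not cross (1, v) either.\<close>
        have "E 1 v"
        proof (rule mx)
          fix k l assume kl: "E k l"
          show "\<not> crosses 1 v k l"
          proof (cases "k = 0")
            case True
            show ?thesis
            proof
              assume "crosses 1 v k l"
              then have "1 < l" "l < v" using True by (auto simp: crosses_def)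
              then show False using z(4)[of l] kl True \<open>z = 1\<close> by simp
            qed
          next
            case False
            then have "?R k l" using kl lt by (auto simp: contract_chords_def)
            then show ?thesis using c 2 by blast
          qed
        qed (use uv 2 in auto)
        then show False using nE by simp
      qed
    next
      case 3
      have "E u v"
      proof (rule mx[OF uv])
        fix k l assume kl: "E k l"
        show "\<not> crosses u v k l"
        proof (cases "k = 0 \<and> l > 1")
          case True
          then have "?R 1 l" using kl by (auto simp: contract_chords_def)
          then show ?thesis using c[of 1 l] 3 True by (auto simp: crosses_def)
        next
          case False
          then have "?R k l" using kl lt[OF kl] by (auto simp: contract_chords_def)
          then show ?thesis using c by blast
        qed
      qed
      then show ?thesis using 3 uv by (auto simp: contract_chords_def)
    qed
  qed
  show ?thesis unfolding chord_triangulation_def using lt' nc' mx' by blast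
qed

text \<open>With the ear chord present, the only neighbours of 0 are 1 and n - 1, and the image of
  (0, n - 1) is the ear chord itself. This gives one inclusion, and maximality the equality.\<close>

lemma contract_chords_ear:
  assumes n: "n \<ge> 3" and E: "chord_triangulation n E" and ear: "E 1 (n - 1)"
  shows "contract_chords n E = E"
proof (rule chord_triangulation_maximal[OF chord_triangulation_contract_chords[OF n E] E])
  fix i j assume a: "contract_chords n E i j"
  note E01 = chord_triangulation_outer(1)[OF E n] and E0n = chord_triangulation_outer(2)[OF E n]
  have "j = 1 \<or> j = n - 1" if "E 0 j"
    using chord_triangulation_ear[OF E ear that] .
  then show "E i j" using a E01 E0n ear by (auto simp: contract_chords_def)
qed

text \<open>The sign pattern to which the geometry is reduced. The ear chord (1, n - 1) may have any
  sign, 0 included. By \<open>mono\<close>, a ray turning about vertex 0 passes the puncture only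
  once: the signs of (0, j) go from positive to negative, with at most one 0 between.\<close>

locale central_puncture =
  fixes n :: nat and \<sigma> :: "nat \<Rightarrow> nat \<Rightarrow> real"
  assumes n4: "n \<ge> 4"
    and pos: "0 < i \<Longrightarrow> i < j \<Longrightarrow> j < n \<Longrightarrow> (i, j) \<noteq> (1, n - 1) \<Longrightarrow> \<sigma> i j > 0"
    and first: "\<sigma> 0 1 > 0" and last: "\<sigma> 0 (n - 1) < 0"
    and mono: "0 < i \<Longrightarrow> i < j \<Longrightarrow> j < n \<Longrightarrow> \<sigma> 0 j \<ge> 0 \<Longrightarrow> \<sigma> 0 i > 0"
begin

text \<open>Every retained chord avoiding 0 has the puncture on the side of 0, hence crosses (0, s)
  only if it crosses the spoke to \<open>s\<close>. For maximality, a dropped ear chord must be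
  crossed by something (\<open>central\<close>), and a missing chord (0, v) must be blocked by a
  retained one.\<close>

lemma chord_triangulation_contract_spokes:
  assumes EQ: "spoked_triangulation n \<sigma> E Q"
  shows "chord_triangulation n (contract_spokes n \<sigma> E Q)"
proof -
  let ?R = "contract_spokes n \<sigma> E Q"
  have lt: "E i j \<Longrightarrow> i < j \<and> j < n \<and> \<sigma> i j \<noteq> 0"
    and Qn: "Q s \<Longrightarrow> s < n"
    and nc: "E i j \<Longrightarrow> E k l \<Longrightarrow> \<not> crosses i j k l" 
    and ncQ: "E i j \<Longrightarrow> Q s \<Longrightarrow> \<not> spoke_crosses \<sigma> s i j" 
    and mx: "i < j \<Longrightarrow> j < n \<Longrightarrow> \<sigma> i j \<noteq> 0 \<Longrightarrow> (\<And>k l. E k l \<Longrightarrow> \<not> crosses i j k l)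
       \<Longrightarrow> (\<And>s. Q s \<Longrightarrow> \<not> spoke_crosses \<sigma> s i j) \<Longrightarrow> E i j" 
    and mxQ: "s < n \<Longrightarrow> (\<And>i j. E i j \<Longrightarrow> \<not> spoke_crosses \<sigma> s i j) \<Longrightarrow> Q s" for i j k l s
    using EQ unfolding spoked_triangulation_def by meson+
  have E01: "E 0 1" by (rule mx) (use n4 lt first in \<open>auto simp: crosses_def spoke_crosses_def\<close>)
  have E0n: "E 0 (n-1)" by (rule mx) (use n4 lt last Qn in \<open>force simp: crosses_def spoke_crosses_def\<close>)+
  have E12: "E 1 2" by (rule mx) (use n4 lt pos[of 1 2] in \<open>force simp: crosses_def spoke_crosses_def\<close>)+
  have lt': "?R i j \<Longrightarrow> i < j \<and> j < n" for i j
    using lt Qn by (auto simp: contract_spokes_def split: if_splits)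
  have spk: "\<not> crosses 0 s i j" if "Q s" "?R i j" for s i j
  proof (cases "i = 0")
    case True then show ?thesis by (auto simp: crosses_def)
  next
    case False
    then have e: "E i j" and "\<sigma> i j > 0"
      using that(2) pos[of i j] lt[of i j] by (auto simp: contract_spokes_def split: if_splits)
    then show ?thesis using ncQ[OF e that(1)] False by (auto simp: crosses_def spoke_crosses_def)
  qed
  have sym: "crosses i j k l = crosses k l i j" for i j k l by (auto simp: crosses_def)
  have nc': "\<not> crosses i j k l" if a: "?R i j" and b: "?R k l" for i j k l
  proof -
    consider "E i j" "E k l" | "i = 0" "Q j" | "k = 0" "Q l"
      using a b by (auto simp: contract_spokes_def split: if_splits)
    then show ?thesis by cases (use nc spk sym a b in blast)+
  qed
  \<comment> \<open>If the ear chord is dropped, some arc must contract to a chord crossing it.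
    Otherwise let \<open>m\<close> be the last neighbour of 1 before n - 1: a chord blocking the
    spoke to \<open>m\<close> would join 1 to a vertex between \<open>m\<close> and n - 1, or cross
    (1, m).\<close>
  have central: "\<exists>j. 1 < j \<and> j < n - 1 \<and> (E 0 j \<or> Q j)" if "\<not> \<sigma> 1 (n - 1) > 0"
  proof (rule ccontr)
    assume neg: "\<not> ?thesis"
    have "E 1 2 \<and> 2 < n - 1" "2 \<le> n" using E12 n4 by auto
    then obtain m where m: "E 1 m \<and> m < n - 1" "2 \<le> m" "m \<le> n"
        "\<And>y. E 1 y \<and> y < n - 1 \<Longrightarrow> y \<le> n \<Longrightarrow> y \<le> m"
      using greatest_neighbour[of "\<lambda>m. E 1 m \<and> m < n - 1" 2 n] by blast
    have "\<not> Q m" using neg m by auto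
    then obtain k l where kl: "E k l" "spoke_crosses \<sigma> m k l" using mxQ[of m] m less_diff_conv[of m n 1] by (metis add_lessD1)
    show False
    proof (cases "k = 0")
      case True
      then have "\<not> (1 < l \<and> l < n - 1)" using neg kl(1) by blast
      then have "l = 1 \<or> l = n - 1" using lt[OF kl(1)] True by linarith
      then show False using True kl m first last by (auto simp: spoke_crosses_def)
    next
      case False
      have "(k, l) \<noteq> (1, n - 1)"
        using that kl m lt[OF kl(1)] by (auto simp: spoke_crosses_def)
      then have s: "\<sigma> k l > 0" using pos False lt[OF kl(1)] by auto
      then have "k < m" "m < l" using kl(2) by (auto simp: spoke_crosses_def)
      moreover have "l < n - 1" if "k = 1" using lt[OF kl(1)] that \<open>(k, l) \<noteq> (1, n - 1)\<close> by auto
      ultimately show False using nc[of 1 m k l] m(1) kl(1) m(4)[of l] False lt[OF kl(1)]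
        by (cases "k = 1") (auto simp: crosses_def)
    qed
  qed
  have mx': "?R u v" if uv: "u < v" "v < n" and c: "\<And>k l. ?R k l \<Longrightarrow> \<not> crosses u v k l" for u v
  proof -
    have cQ: "\<not> crosses u v 0 s" if "Q s" "s > 0" for s
      using c[of 0 s] that by (auto simp: contract_spokes_def)
    have cE: "\<not> crosses u v k l" if "E k l" "(k, l) = (1, n - 1) \<Longrightarrow> \<sigma> 1 (n - 1) > 0" for k l
      by (rule c) (use that lt[of k l] in \<open>cases "k = 0"; simp add: contract_spokes_def\<close>)
    consider "u > 0" "\<sigma> u v > 0" | "u > 0" "\<not> \<sigma> u v > 0" | "u = 0" by linarith
    then show ?thesis
    proof cases
      case 1
      have "E u v"
      proof (rule mx[OF uv])
        fix k l assume kl: "E k l"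
        show "\<not> crosses u v k l"
        proof (cases "(k, l) = (1, n - 1)")
          case True
          then show ?thesis using 1 uv by (auto simp: crosses_def)
        qed (use cE kl in blast)
      next
        fix s assume "Q s"
        then show "\<not> spoke_crosses \<sigma> s u v" using cQ[of s] 1 by (auto simp: crosses_def spoke_crosses_def)
      qed (use 1 in simp)
      then show ?thesis using 1 uv by (auto simp: contract_spokes_def)
    next
      case 2
      then have e: "u = 1" "v = n - 1" using pos[of u v] uv by auto
      then obtain j where "1 < j" "j < n - 1" "E 0 j \<or> Q j" using central 2 by blast
      then have "?R 0 j" by (auto simp: contract_spokes_def)
      then show ?thesis using c[of 0 j] e \<open>1 < j\<close> \<open>j < n - 1\<close> by (auto simp: crosses_def)
    next
      case 3
      show ?thesis
      proof (rule ccontr)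
        assume "\<not> ?R u v"
        then have nE: "\<not> E 0 v" "\<not> Q v" using 3 uv by (auto simp: contract_spokes_def)
        then have v1: "v \<noteq> 1" "v \<noteq> n - 1" using E01 E0n by auto
        obtain i j where ij: "E i j" "spoke_crosses \<sigma> v i j" using mxQ[OF uv(2)] nE by auto
        \<comment> \<open>A blocker avoiding 0 would be retained and cross (0, v), unless it is the
          ear chord with nonpositive sign, which blocks no spoke to \<open>v\<close>.\<close>
        have i0: "i = 0"
        proof (rule ccontr)
          assume i: "i \<noteq> 0"
          show False
          proof (cases "\<sigma> i j > 0")
            case True
            then show ?thesis using cE[OF ij(1)] ij(2) i 3 by (auto simp: spoke_crosses_def crosses_def)
          next
            case False
            then have "(i, j) = (1, n - 1)" using pos[of i j] i lt[OF ij(1)] by auto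
            then show False using False ij(2) v1 uv 3 by (auto simp: spoke_crosses_def)
          qed
        qed
        obtain z where z: "E 0 z" "1 \<le> z" "z \<le> v" "\<And>y. E 0 y \<Longrightarrow> y \<le> v \<Longrightarrow> y \<le> z"
          using greatest_neighbour[of "E 0" 1 v] E01 uv 3 by auto
        have "v \<le> n - 1" using uv by linarith
        then obtain w where w: "E 0 w" "v \<le> w" "w \<le> n - 1" "\<And>y. E 0 y \<Longrightarrow> v \<le> y \<Longrightarrow> w \<le> y"
          using least_neighbour[of "E 0" "n - 1" v, OF E0n] by blast
        have zv: "z < v" "v < w" using z w nE by (metis le_neq_implies_less)+
        have ne: "(z, w) \<noteq> (1, n - 1)"
        proof
          assume e: "(z, w) = (1, n - 1)"
          then have "j = 1 \<or> j = n - 1" using z(4)[of j] w(4)[of j] ij i0 lt[OF ij(1)]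
            by (cases "j \<le> v") auto
          then show False using ij i0 v1 uv 3 first last by (auto simp: spoke_crosses_def)
        qed
        \<comment> \<open>The blocking chord (0, j) shows that the puncture lies outside the sector
          at 0 between \<open>z\<close> and \<open>w\<close>. So no spoke of \<open>Q\<close> ends
          strictly between them without crossing (0, z) or (0, w); hence (z, w) is in
          \<open>E\<close>, and it crosses (0, v).\<close>
        have one_sided: "\<sigma> 0 w > 0 \<or> \<sigma> 0 z < 0"
        proof (cases "\<sigma> 0 j > 0")
          case True
          then have "v < j" using ij i0 by (auto simp: spoke_crosses_def)
          then have "w \<le> j" using w(4) ij i0 by auto
          then show ?thesis using mono[of w j] True zv lt[OF ij(1)] by (cases "w = j") auto
        next
          case False
          then have "j < v" "\<sigma> 0 j < 0" using ij i0 by (auto simp: spoke_crosses_def)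
          then have "j \<le> z" using z(4) ij i0 by auto
          then show ?thesis using mono[of j z] False zv lt[OF ij(1)] lt[OF z(1)] \<open>\<sigma> 0 j < 0\<close>
            by (cases "z = j") (auto simp: not_le)
        qed
        have szw: "\<sigma> z w > 0" using pos[of z w] ne zv z w lt[OF w(1)] by auto
        have "E z w"
        proof (rule mx)
          fix k l assume "E k l"
          show "\<not> crosses z w k l"
          proof (rule no_crossing_between_neighbours[where E=E])
            fix y assume "E 0 y" "z < y" "y < w"
            then show False using z(4)[of y] w(4)[of y] by linarith
          qed (use nc lt z w \<open>E k l\<close> in auto)
        next
          fix s assume "Q s"
          then show "\<not> spoke_crosses \<sigma> s z w"
            using one_sided ncQ[OF z(1) \<open>Q s\<close>] ncQ[OF w(1) \<open>Q s\<close>] szw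
            by (auto simp: spoke_crosses_def)
        qed (use zv w n4 szw in auto)
        then have R: "?R z w" using z zv ne by (auto simp: contract_spokes_def)
        then show False using c[OF R] zv z(2) 3 by (auto simp: crosses_def)
      qed
    qed
  qed
  show ?thesis unfolding chord_triangulation_def using lt' nc' mx' by blast
qed

section \<open>Inserting the puncture, then contracting it\<close>

lemma insertion_outside_ear:
  assumes E: "chord_triangulation n E"
    and R: "chord_triangulation n (contract_spokes n \<sigma> E' Q)"
    and E'E: "\<And>i j. E' i j \<Longrightarrow> E i j" and Q: "\<And>j. Q j \<Longrightarrow> 0 < j \<Longrightarrow> E 0 j"
  shows "contract_spokes n \<sigma> E' Q = E"
  by (rule chord_triangulation_maximal[OF R E])
    (auto simp: contract_spokes_def E'E Q split: if_splits)

text \<open>The assumptions on \<open>E'\<close> cover both kinds of insertion: the ear chord is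
  kept if the puncture lies in the triangle behind it and removed if the puncture lies on it.
  Contraction to 0 can only trade (1, n - 1) for (0, m); contraction to 1 turns (0, m) into (1, m),
  which is already there, and restores the ear chord.\<close>

lemma insertion_across_ear:
  assumes E: "chord_triangulation n E" and ear: "E 1 (n - 1)"
    and R: "chord_triangulation n (contract_spokes n \<sigma> E' Q)"
    and E': "\<And>i j. E' i j \<Longrightarrow> E i j" "\<And>i j. E i j \<Longrightarrow> (i, j) \<noteq> (1, n - 1) \<Longrightarrow> E' i j"
    and Q: "\<And>j. Q j \<Longrightarrow> j = 0 \<or> j = 1 \<or> j = m \<or> j = n - 1" and m: "E 1 m"
  defines "R \<equiv> contract_spokes n \<sigma> E' Q"
  shows "contract_chords n R = E" "E i j \<Longrightarrow> \<not> R i j \<Longrightarrow> (i, j) = (1, n - 1)"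
    "R i j \<Longrightarrow> \<not> E i j \<Longrightarrow> (i, j) = (0, m)"
proof -
  have n3: "n \<ge> 3" using n4 by simp
  note outer = chord_triangulation_outer[OF E n3]
  have lt: "E i j \<Longrightarrow> i < j \<and> j < n" for i j using E unfolding chord_triangulation_def by meson
  have R_E: "E i j" if "R i j" "i > 0" for i j
    using that E' by (auto simp: R_def contract_spokes_def)
  have R_0: "j = 1 \<or> j = m \<or> j = n - 1" if "R 0 j" for j
    using that Q E' chord_triangulation_ear[OF E ear, of j] by (auto simp: R_def contract_spokes_def)
  show "contract_chords n R = E"
  proof (rule chord_triangulation_maximal[OF chord_triangulation_contract_chords[OF n3 R[folded R_def]] E])
    fix i j assume "contract_chords n R i j"
    then show "E i j" using outer R_E R_0 m ear unfolding contract_chords_def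
      by (cases "i = 0") fastforce+
  qed
  have E_R: "R i j" if "E i j" "(i, j) \<noteq> (1, n - 1)" for i j
    using that E'(2)[OF that] lt[OF that(1)] by (cases "i = 0") (auto simp: R_def contract_spokes_def)
  then show "E i j \<Longrightarrow> \<not> R i j \<Longrightarrow> (i, j) = (1, n - 1)" by blast
  show "(i, j) = (0, m)" if "R i j" "\<not> E i j"
    using that R_E R_0[of j] outer by (cases "i = 0") auto
qed

text \<open>The negative sign says that the puncture lies on the side of \<open>j\<close>. For
  \<open>i > 0\<close> this is possible only at the ear chord; for \<open>i = 0\<close> all spokes
  end at 0 or its neighbours, so contraction returns \<open>E\<close>.\<close>

lemma insertion_into_triangle:
  assumes E: "chord_triangulation n E"
    and R: "chord_triangulation n (contract_spokes n \<sigma> E Q)"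
    and Q: "\<And>s. Q s \<Longrightarrow> s = i \<or> s = j \<or> s = k"
    and tri: "E i j" "E j k" "E i k" and "\<sigma> i k < 0"
  shows "contract_spokes n \<sigma> E Q = E \<or> E 1 (n - 1) \<and> E 1 j \<and> i = 1 \<and> k = n - 1"
proof (cases "i = 0")
  case True
  then show ?thesis using insertion_outside_ear[OF E R _ ] Q tri by blast
next
  case False
  have "i < k \<and> k < n" using E tri unfolding chord_triangulation_def by meson
  then have "(i, k) = (1, n - 1)" using pos[of i k] False assms by auto
  then show ?thesis using tri by auto
qed

text \<open>An edge through the puncture has sign 0, so it ends at vertex 0 or is the ear chord. In
  the first case all spokes end at 0 or its neighbours; in the second, one apex is 0 and the other
  lies beyond the ear chord.\<close>

lemma insertion_into_edge:
  assumes E: "chord_triangulation n E"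
    and R: "chord_triangulation n (contract_spokes n \<sigma> E' Q)"
    and E': "\<And>i j. E' i j \<Longrightarrow> E i j"
    and Q: "\<And>s. Q s \<Longrightarrow> s = x \<or> s = y \<or> s = z \<or> s = w"
    and xy: "E x y" "\<sigma> x y = 0" and zw: "z \<noteq> w"
    and tri: "E x z \<or> E z x" "E y z \<or> E z y" "E x w \<or> E w x" "E y w \<or> E w y"
  shows "contract_spokes n \<sigma> E' Q = E \<or>
    E 1 (n - 1) \<and> x = 1 \<and> y = n - 1 \<and> (z = 0 \<and> E 1 w \<or> w = 0 \<and> E 1 z)"
proof (cases "x = 0")
  case True
  have lt: "E i j \<Longrightarrow> i < j \<and> j < n" for i j using E unfolding chord_triangulation_def by meson
  have "E 0 j" if "Q j" "0 < j" for j
    using Q[OF that(1)] that(2) xy(1) tri True lt[of j 0] by auto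
  then show ?thesis using insertion_outside_ear[OF E R E'] by blast
next
  case False
  have lt: "E i j \<Longrightarrow> i < j \<and> j < n" for i j using E unfolding chord_triangulation_def by meson
  have nc: "E i j \<Longrightarrow> E k l \<Longrightarrow> \<not> crosses i j k l" for i j k l
    using E unfolding chord_triangulation_def by meson
  have xy': "x = 1" "y = n - 1" using pos[of x y] False xy lt[OF xy(1)] by auto
  have third: "v = 0 \<or> E 1 v \<and> E v (n - 1)" if "E x v \<or> E v x" "E y v \<or> E v y" for v
    using that lt[of x v] lt[of v x] lt[of y v] lt[of v y] unfolding xy' by (cases "v = 0") auto
  \<comment> \<open>Two apexes beyond the ear chord would give crossing sides: for
    \<open>z < w\<close>, (1, w) crosses (z, n - 1).\<close>
  have "False" if "z \<noteq> 0" "w \<noteq> 0"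
  proof -
    have "E 1 z" "E z (n - 1)" "E 1 w" "E w (n - 1)" using third tri that by auto
    then show False using nc[of 1 w z "n - 1"] nc[of 1 z w "n - 1"] zw
        lt[of 1 z] lt[of 1 w] lt[of z "n - 1"] lt[of w "n - 1"]
      by (cases "z < w") (auto simp: crosses_def)
  qed
  then show ?thesis using third[of z] third[of w] tri xy xy' zw by auto
qed

end

section \<open>Geodesics and pairs of projections\<close>

text \<open>Arcs collapsed by \<open>f\<close> are deleted from the image walk, so a single
  collapsed arc already makes it strictly shorter. This strictness is what contradicts minimality of
  a geodesic.\<close>

lemma collapse_vwalk:
  assumes "w \<noteq> []" and "\<And>x y. (x, y) \<in> set (vwalk_arcs w) \<Longrightarrow> f x = f y \<or> (f x, f y) \<in> A"
  obtains w' where "w' \<noteq> []" "set w' \<subseteq> f ` set w" "set (vwalk_arcs w') \<subseteq> A"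
    "hd w' = f (hd w)" "last w' = f (last w)" "length w' \<le> length w"
    "\<And>x y. (x, y) \<in> set (vwalk_arcs w) \<Longrightarrow> f x = f y \<Longrightarrow> length w' < length w"
proof -
  have "\<exists>w'. w' \<noteq> [] \<and> set w' \<subseteq> f ` set w \<and> set (vwalk_arcs w') \<subseteq> A \<and>
    hd w' = f (hd w) \<and> last w' = f (last w) \<and> length w' \<le> length w \<and>
    ((\<exists>(x, y) \<in> set (vwalk_arcs w). f x = f y) \<longrightarrow> length w' < length w)"
    using assms
  proof (induction w rule: vwalk_arcs.induct)
    case (2 x)
    then show ?case by (intro exI[of _ "[f x]"]) auto
  next
    case (3 x y xs)
    then obtain w' where w': "w' \<noteq> []" "set w' \<subseteq> f ` set (y # xs)" "set (vwalk_arcs w') \<subseteq> A"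
      "hd w' = f y" "last w' = f (last (y # xs))" "length w' \<le> length (y # xs)"
      "(\<exists>(x, y) \<in> set (vwalk_arcs (y # xs)). f x = f y) \<longrightarrow> length w' < length (y # xs)"
      by (metis (no_types, lifting) list.sel(1) list.set_intros(2) neq_Nil_conv vwalk_arcs.simps(3))
    show ?case
    proof (cases "f x = f y")
      case True
      then show ?thesis using w' by (intro exI[of _ w']) auto
    next
      case False
      then have "(f x, f y) \<in> A" using 3 by auto
      then show ?thesis using w' False by (intro exI[of _ "f x # w'"]) auto
    qed
  qed auto
  then show ?thesis using that by blast
qed

lemma vwalk_replace_segment:
  assumes "vwalk (a @ m @ b) G" and "vwalk m' G" "hd m' = hd m" "last m' = last m" "m \<noteq> []"
  shows "vwalk (a @ m' @ b) G"
proof -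
  have arcs: "set (vwalk_arcs (a @ m @ b)) = set (vwalk_arcs a) \<union> set (vwalk_arcs m) \<union> set (vwalk_arcs b)
      \<union> (if a = [] then {} else {(last a, hd m)}) \<union> (if b = [] then {} else {(last m, hd b)})"
    if "m \<noteq> []" for m :: "'a list"
    using that by (cases "a = []"; cases "b = []") (auto simp: vwalk_arcs_append)
  have "m' \<noteq> []" using assms by auto
  then show ?thesis using assms arcs[of m] arcs[of m'] unfolding vwalk_def by (auto split: if_splits)
qed

lemma vwalk_map:
  assumes "vwalk w (with_proj X)"
  shows "vwalk (map f w) (with_proj (image_graph f X))"
proof -
  have "vwalk_arcs (map f w) = map (map_prod f f) (vwalk_arcs w)"
    by (induction w rule: vwalk_arcs.induct) auto
  then show ?thesis using assms by (auto simp: vwalk_def image_graph_def)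
qed

text \<open>
  The members of \<open>G\<close> are the vertices through which a geodesic could possibly leave the left summand:
  at all others, \<open>\<phi>\<close> undoes the exit and shortens the walk.
\<close>

locale flip_projections =
  fixes F :: "'a pair_pre_digraph" and F' :: "'b pair_pre_digraph" and I :: "('a \<times> 'b) set"
    and \<phi> :: "'b \<Rightarrow> 'a" and \<rho> :: "'a \<Rightarrow> 'a" and G :: "'a set"
  assumes wf: "parcs F \<subseteq> pverts F \<times> pverts F" "parcs F' \<subseteq> pverts F' \<times> pverts F'"
      "I \<subseteq> pverts F \<times> pverts F'"
    and sym: "(T, U) \<in> parcs F \<Longrightarrow> (U, T) \<in> parcs F"
    and \<phi>_in: "T' \<in> pverts F' \<Longrightarrow> \<phi> T' \<in> pverts F"
    and \<phi>_arc: "(T', U') \<in> parcs F' \<Longrightarrow> \<phi> T' = \<phi> U' \<or> (\<phi> T', \<phi> U') \<in> parcs F"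
    and \<rho>_in: "T \<in> pverts F \<Longrightarrow> \<rho> T \<in> pverts F"
    and \<rho>_arc: "(T, U) \<in> parcs F \<Longrightarrow> \<rho> T = \<rho> U \<or> (\<rho> T, \<rho> U) \<in> parcs F"
    and \<rho>_fix: "T \<in> G \<Longrightarrow> \<rho> T = T"
    and insertion: "(T, T') \<in> I \<Longrightarrow>
      \<phi> T' = T \<or> T \<in> G \<and> \<rho> (\<phi> T') = T \<and> (T, \<phi> T') \<in> parcs F"
begin

definition joined :: "('a + 'b) pair_pre_digraph" where
  "joined = \<lparr> pverts = Inl ` pverts F \<union> Inr ` pverts F',
     parcs = map_prod Inl Inl ` parcs F \<union> map_prod Inr Inr ` parcs F'
       \<union> (\<lambda>(T, T'). (Inl T, Inr T')) ` I \<union> ((\<lambda>(T, T'). (Inl T, Inr T')) ` I)\<inverse> \<rparr>"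

definition retract :: "'a + 'b \<Rightarrow> 'a" where
  "retract = case_sum id \<phi>"

lemma retract_in: "x \<in> pverts joined \<Longrightarrow> retract x \<in> pverts F"
  using \<phi>_in by (auto simp: joined_def retract_def)

lemma retract_arc:
  "(x, y) \<in> parcs joined \<Longrightarrow> retract x = retract y \<or> (retract x, retract y) \<in> parcs F"
  using \<phi>_arc insertion sym by (fastforce simp: joined_def retract_def)

lemma image_subgraph: "subgraph (with_proj (image_graph Inl F)) (with_proj joined)"
proof -
  have "wf_digraph (with_proj (image_graph Inl F))" "wf_digraph (with_proj joined)"
    using wf by (unfold_locales; auto simp: joined_def image_graph_def)+
  then show ?thesis
    by (auto simp: subgraph_def compatible_def joined_def image_graph_def)
qed

lemma vwalk_image_imp_joined:
  "vwalk w (with_proj (image_graph Inl F)) \<Longrightarrow> vwalk w (with_proj joined)"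
  by (auto simp: vwalk_def image_graph_def joined_def)

text \<open>\<open>retract\<close> fixes the left summand and never lengthens a walk, so a collapsed
  arc would give a shorter walk with the same ends.\<close>

lemma geodesic_arc_not_collapsed:
  assumes geo: "geodesic joined (Inl u) (Inl v) w" and xy: "(x, y) \<in> set (vwalk_arcs w)"
  shows "retract x \<noteq> retract y"
proof
  assume eq: "retract x = retract y"
  have w: "vwalk w (with_proj joined)" "hd w = Inl u" "last w = Inl v"
    using geo by (auto simp: geodesic_def)
  obtain w' where w': "w' \<noteq> []" "set w' \<subseteq> retract ` set w" "set (vwalk_arcs w') \<subseteq> parcs F"
    "hd w' = retract (hd w)" "last w' = retract (last w)"
    "length w' < length w"
  proof (rule collapse_vwalk[of w retract "parcs F"])
    show "w \<noteq> []" using w by auto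
    show "retract x = retract y \<or> (retract x, retract y) \<in> parcs F"
      if "(x, y) \<in> set (vwalk_arcs w)" for x y
      using retract_arc w that by (auto simp: vwalk_def)
  qed (use that eq xy in blast)
  have "vwalk w' (with_proj F)" using w' w retract_in by (fastforce simp: vwalk_def)
  then have "vwalk (map Inl w') (with_proj joined)" using vwalk_image_imp_joined vwalk_map by blast
  then have "vwalk_length w \<le> vwalk_length (map Inl w')"
    using geo w' w by (auto simp: geodesic_def retract_def hd_map last_map)
  moreover have "0 < length w'" using w' by simp
  ultimately show False using w'(6) unfolding vwalk_length_simp length_map by arith
qed

text \<open>Since no arc of a geodesic collapses under \<open>retract\<close>, a first exit and a
  last return can only happen at members of \<open>G\<close>. The stretch between them is projected
  by \<open>retract\<close> followed by \<open>\<rho>\<close>, which fixes both of its ends.\<close>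

lemma geodesic_stays:
  assumes geo: "geodesic joined (Inl u) (Inl v) w"
  shows "vwalk w (with_proj (image_graph Inl F))"
proof -
  have w: "vwalk w (with_proj joined)" "hd w = Inl u" "last w = Inl v"
    using geo by (auto simp: geodesic_def)
  have left: "isl x" if "x \<in> set w" for x
  proof (rule ccontr)
    assume "\<not> isl x"
    then obtain a' x' zs where s1: "w = a' @ x' # zs" "\<not> isl x'" "\<forall>y\<in>set a'. \<not> \<not> isl y"
      using split_list_first_prop[of w "\<lambda>x. \<not> isl x"] \<open>x \<in> set w\<close> by metis
    obtain T' where T': "x' = Inr T'" using s1 by (cases x') auto
    have "a' \<noteq> []" using s1 w T' by (cases a') auto
    then obtain a T where a: "a' = a @ [Inl T]" using s1 by (metis isl_def last_in_set append_butlast_last_id)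
    \<comment> \<open>The last vertex of the right summand; it is the exit vertex itself when
      \<open>c\<close> is empty. Visits to the left summand in between do no harm.\<close>
    obtain c y' d where s2: "Inr T' # zs = c @ y' # d" "\<not> isl y'" "\<forall>y\<in>set d. \<not> \<not> isl y"
      using split_list_last_prop[of "Inr T' # zs" "\<lambda>x. \<not> isl x"] by (auto simp: isl_def)
    obtain U' where U': "y' = Inr U'" using s2 by (cases y') auto
    have wd: "w = a @ Inl T # c @ y' # d" using s1 s2 a T' by simp
    have "d \<noteq> []" using w(3) U' unfolding wd by (cases d) auto
    then obtain U b where d: "d = Inl U # b" using s2 by (metis isl_def list.set_intros(1) neq_Nil_conv)
    define m where "m = Inl T # c @ [Inr U', Inl U]"
    have wm: "w = a @ m @ b" using wd d U' by (simp add: m_def)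
    have m_arcs: "set (vwalk_arcs m) \<subseteq> set (vwalk_arcs w)"
      unfolding wm using set_vwalk_arcs_append1 set_vwalk_arcs_append2 by fastforce
    have m1: "(Inl T, Inr T') \<in> set (vwalk_arcs m)"
      using s2(1) U' by (cases c) (auto simp: m_def)
    have m2: "(Inr U', Inl U) \<in> set (vwalk_arcs m)"
      using set_vwalk_arcs_append2[of "[Inr U', Inl U]" "Inl T # c"] by (simp add: m_def)
    have arcs: "set (vwalk_arcs w) \<subseteq> parcs joined" using w by (auto simp: vwalk_def)
    have "(T, T') \<in> I" "(U, U') \<in> I"
      using m1 m2 m_arcs arcs by (auto simp: joined_def)
    moreover have "\<phi> T' \<noteq> T" "\<phi> U' \<noteq> U"
      using geodesic_arc_not_collapsed[OF geo] m1 m2 m_arcs by (force simp: retract_def)+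
    ultimately have TU: "\<rho> T = T" "\<rho> U = U" "\<rho> (\<phi> T') = T"
      using insertion \<rho>_fix by blast+
    \<comment> \<open>The exit arc is collapsed, because \<open>\<rho> (\<phi> T')\<close> is
      \<open>T\<close> again; the projected stretch is therefore strictly shorter.\<close>
    let ?f = "\<lambda>x. \<rho> (retract x)"
    obtain m' where m': "m' \<noteq> []" "set m' \<subseteq> ?f ` set m" "set (vwalk_arcs m') \<subseteq> parcs F"
      "hd m' = ?f (hd m)" "last m' = ?f (last m)" "length m' < length m"
    proof (rule collapse_vwalk[of m ?f "parcs F"])
      show "m \<noteq> []" by (simp add: m_def)
      show "?f x = ?f y \<or> (?f x, ?f y) \<in> parcs F" if "(x, y) \<in> set (vwalk_arcs m)" for x y
        using retract_arc[of x y] \<rho>_arc that m_arcs arcs by fastforce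
    qed (use that TU m1 in \<open>fastforce simp: retract_def\<close>)
    have "set m \<subseteq> pverts joined" using w(1) wm by (auto simp: vwalk_def)
    then have "vwalk m' (with_proj F)" using m' retract_in \<rho>_in by (fastforce simp: vwalk_def)
    then have "vwalk (map Inl m') (with_proj joined)" using vwalk_image_imp_joined vwalk_map by blast
    then have "vwalk (a @ map Inl m' @ b) (with_proj joined)"
    proof (rule vwalk_replace_segment[OF w(1)[unfolded wm]])
      show "hd (map Inl m') = hd m" "last (map Inl m') = last m" "m \<noteq> []"
        using m' TU by (auto simp: m_def retract_def hd_map last_map)
    qed
    moreover have "hd (a @ map Inl m' @ b) = Inl u" "last (a @ map Inl m' @ b) = Inl v"
      using w(2,3) m' TU unfolding wm
      by (auto simp: m_def retract_def hd_append last_append hd_map last_map split: if_splits)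
    ultimately have "vwalk_length w \<le> vwalk_length (a @ map Inl m' @ b)"
      using geo unfolding geodesic_def by blast
    moreover have "0 < length m'" using m' by simp
    ultimately show False using m'(6) unfolding wm vwalk_length_simp length_map length_append by arith
  qed
  have "x \<in> pverts (image_graph Inl F)" if "x \<in> set w" for x
    using left[OF that] w(1) that by (auto simp: vwalk_def joined_def image_graph_def)
  moreover have "e \<in> parcs (image_graph Inl F)" if "e \<in> set (vwalk_arcs w)" for e
  proof -
    have "fst e \<in> set w \<and> snd e \<in> set w"
      using that by (induction w rule: vwalk_arcs.induct) auto
    then obtain a b where ab: "e = (Inl a, Inl b)" using left by (metis isl_def prod.collapse)
    have "e \<in> parcs joined" using w(1) that by (auto simp: vwalk_def)
    then have "(a, b) \<in> parcs F" unfolding ab by (auto simp: joined_def)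
    then show ?thesis unfolding ab by (force simp: image_graph_def)
  qed
  ultimately show ?thesis using w(1) by (auto simp: vwalk_def)
qed

lemma strongly_convex_embedding: "strongly_convex_embedding Inl F joined"
  unfolding strongly_convex_embedding_def strongly_convex_def
proof (intro conjI ballI allI impI image_subgraph)
  show "inj_on Inl (pverts F)" by simp
  fix u v :: "'a + 'b" and w
  assume "u \<in> pverts (image_graph Inl F)" "v \<in> pverts (image_graph Inl F)" "geodesic joined u v w"
  then show "vwalk w (with_proj (image_graph Inl F))"
    using geodesic_stays by (auto simp only: image_graph_def pair_pre_digraph.simps)
qed

end

section \<open>Orientation in the plane\<close>

text \<open>Twice the signed area of the triangle, positive when \<open>a\<close>, \<open>b\<close>,
  \<open>c\<close> turn counterclockwise.\<close>

definition orient :: "real^2 \<Rightarrow> real^2 \<Rightarrow> real^2 \<Rightarrow> real" where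
  "orient a b c = (b$1 - a$1) * (c$2 - a$2) - (b$2 - a$2) * (c$1 - a$1)"

lemma orient_rotate: "orient b c a = orient a b c"
  and orient_swap: "orient b a c = - orient a b c"
  and orient_swap': "orient a c b = - orient a b c"
  by (simp_all add: orient_def algebra_simps)

lemma orient_same [simp]: "orient a a b = 0" "orient a b a = 0" "orient a b b = 0"
  by (simp_all add: orient_def)

lemma orient_convex_combination:
  "orient a b ((1 - u) *\<^sub>R x + u *\<^sub>R y) = (1 - u) * orient a b x + u * orient a b y"
  by (simp add: orient_def) (simp add: algebra_simps)

text \<open>Cramer's rule without division: the orientations are the barycentric coordinates of
  \<open>v\<close> scaled by \<open>orient x y z\<close>. The identity survives for degenerate
  triangles.\<close>

lemma orient_barycentric:
  "orient x y z *\<^sub>R v = orient v y z *\<^sub>R x + orient x v z *\<^sub>R y + orient x y v *\<^sub>R z"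
  by (simp add: vec_eq_iff forall_2 orient_def) (simp add: algebra_simps)

lemma orient_barycentric_sum: "orient v y z + orient x v z + orient x y v = orient x y z"
  by (simp add: orient_def algebra_simps)

lemma convex_orient_nonneg: "convex {x. orient a b x \<ge> 0}"
  unfolding convex_alt by (auto simp: orient_convex_combination)

lemma orient_hull_nonneg:
  "(\<And>w. w \<in> W \<Longrightarrow> orient a b w \<ge> 0) \<Longrightarrow> x \<in> convex hull W \<Longrightarrow> orient a b x \<ge> 0"
  using hull_minimal[of W "{x. orient a b x \<ge> 0}" convex] convex_orient_nonneg[of a b] by blast

lemma orient_interior_pos:
  assumes S: "\<And>x. x \<in> S \<Longrightarrow> orient a b x \<ge> 0" and p: "p \<in> interior S" and ab: "a \<noteq> b"
  shows "orient a b p > 0"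
proof -
  obtain e where e: "e > 0" "ball p e \<subseteq> S" using p mem_interior by blast
  \<comment> \<open>\<open>b - a\<close> turned clockwise by a right angle. A step along it lowers
    \<open>orient a b\<close> in proportion to the squared length of \<open>d\<close>, so an
    interior point needs a positive value to stay nonnegative afterwards.\<close>
  define d :: "real^2" where "d = vector [b$2 - a$2, a$1 - b$1]"
  have d: "d$1 = b$2 - a$2" "d$2 = a$1 - b$1" by (simp_all add: d_def)
  have "d \<noteq> 0" using ab d by (auto simp: vec_eq_iff forall_2)
  define t where "t = e / (2 * norm d)"
  have t: "t > 0" "norm (t *\<^sub>R d) < e" using e \<open>d \<noteq> 0\<close> by (auto simp: t_def field_simps)
  have "p + t *\<^sub>R d \<in> S" using e t by (auto simp: dist_norm subset_iff)
  then have "orient a b (p + t *\<^sub>R d) \<ge> 0" using S by blast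
  moreover have "orient a b (p + t *\<^sub>R d) = orient a b p - t * (d$1 * d$1 + d$2 * d$2)"
    unfolding orient_def d by (simp add: d) (simp add: algebra_simps)
  moreover have "d$1 * d$1 + d$2 * d$2 > 0"
    using \<open>d \<noteq> 0\<close> by (auto simp: vec_eq_iff forall_2 sum_squares_gt_zero_iff)
  ultimately show ?thesis using t by (smt (verit) mult_pos_pos)
qed

lemma orient_0_imp_affine:
  assumes "orient a b c = 0" "a \<noteq> b"
  obtains t where "c = (1 - t) *\<^sub>R a + t *\<^sub>R b"
proof -
  have *: "c = (1 - t) *\<^sub>R a + t *\<^sub>R b" if "t * (b$1 - a$1) = c$1 - a$1" "t * (b$2 - a$2) = c$2 - a$2" for t
    using that by (simp add: vec_eq_iff forall_2 algebra_simps)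
  have eq: "(b$1 - a$1) * (c$2 - a$2) = (b$2 - a$2) * (c$1 - a$1)" using assms(1) by (simp add: orient_def)
  show ?thesis
  proof (cases "a$1 = b$1")
    case False
    have "(c$1 - a$1) / (b$1 - a$1) * (b$2 - a$2) = (b$2 - a$2) * (c$1 - a$1) / (b$1 - a$1)" by simp
    also have "\<dots> = c$2 - a$2" unfolding eq[symmetric] using False by simp
    finally show ?thesis using False by (intro that[OF *, of "(c$1 - a$1) / (b$1 - a$1)"]) auto
  next
    case True
    then have ne: "a$2 \<noteq> b$2" using assms by (auto simp: vec_eq_iff forall_2)
    then show ?thesis using True eq by (intro that[OF *, of "(c$2 - a$2) / (b$2 - a$2)"]) auto
  qed
qed

lemma in_open_segment_orient_0: "z \<in> open_segment a b \<Longrightarrow> orient a b z = 0"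
  by (auto simp: in_segment orient_convex_combination)

lemma open_segments_meet:
  assumes "orient a b c > 0" "orient a b d < 0" "orient c d a < 0" "orient c d b > 0"
  shows "open_segment a b \<inter> open_segment c d \<noteq> {}"
proof -
  \<comment> \<open>\<open>u\<close> is the zero of \<open>orient a b\<close> along the segment from
    \<open>c\<close> to \<open>d\<close>, and \<open>v\<close> that of \<open>orient c d\<close>
    along the segment from \<open>a\<close> to \<open>b\<close>. Their denominators coincide, so the
    two points can be compared after clearing them.\<close>
  define u where "u = orient a b c / (orient a b c - orient a b d)"
  define v where "v = - orient c d a / (orient c d b - orient c d a)"
  have u: "0 < u" "u < 1" and v: "0 < v" "v < 1" using assms by (simp_all add: u_def v_def field_simps)
  have den: "orient c d b - orient c d a = orient a b c - orient a b d"
    by (simp add: orient_def algebra_simps)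
  have "orient a b c - orient a b d \<noteq> 0" using assms by simp
  moreover have "(orient a b c - orient a b d) *\<^sub>R ((1 - v) *\<^sub>R a + v *\<^sub>R b)
      = (orient a b c - orient a b d) *\<^sub>R ((1 - u) *\<^sub>R c + u *\<^sub>R d)"
  proof -
    let ?D = "orient a b c - orient a b d"
    have 1: "?D * (1 - v) = ?D + orient c d a" "?D * v = - orient c d a"
      "?D * (1 - u) = - orient a b d" "?D * u = orient a b c"
      using \<open>?D \<noteq> 0\<close> by (simp_all add: u_def v_def den field_simps)
    show ?thesis unfolding scaleR_add_right scaleR_scaleR 1
      by (simp add: vec_eq_iff forall_2 orient_def) (simp add: algebra_simps)
  qed
  ultimately have eq: "(1 - v) *\<^sub>R a + v *\<^sub>R b = (1 - u) *\<^sub>R c + u *\<^sub>R d" by simp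
  have "a \<noteq> b" "c \<noteq> d" using assms by auto
  then have "(1 - v) *\<^sub>R a + v *\<^sub>R b \<in> open_segment a b" "(1 - v) *\<^sub>R a + v *\<^sub>R b \<in> open_segment c d"
    using u v unfolding eq by (auto simp: in_segment) (metis eq u v)+
  then show ?thesis by blast
qed

text \<open>All of \<open>open_segment c d\<close> lies strictly to the left of the line through
  \<open>a\<close> and \<open>b\<close>, because at least one of its ends does.\<close>

lemma open_segments_disjoint:
  assumes "orient a b c \<ge> 0" "orient a b d \<ge> 0" "orient a b c \<noteq> 0 \<or> orient a b d \<noteq> 0"
  shows "open_segment a b \<inter> open_segment c d = {}"
proof -
  have "orient a b z > 0" if z: "z \<in> open_segment c d" for z
  proof -
    obtain u where u: "0 < u" "u < 1" "z = (1 - u) *\<^sub>R c + u *\<^sub>R d" using z by (auto simp: in_segment)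
    show ?thesis using assms u unfolding u(3) orient_convex_combination
      by (smt (verit) mult_nonneg_nonneg mult_pos_pos)
  qed
  then show ?thesis using in_open_segment_orient_0 by fastforce
qed

text \<open>Weights are left unnormalised so that orientations from
  \<open>orient_barycentric\<close> can be inserted directly. A point extreme in \<open>P\<close> is
  extreme in the smaller hull of \<open>x\<close>, \<open>y\<close>, \<open>z\<close>, hence one of
  these.\<close>

lemma extreme_point_not_weighted:
  assumes P: "convex P" and v: "v extreme_point_of P" and xyz: "{x, y, z} \<subseteq> P - {v}"
    and w: "\<alpha> \<ge> 0" "\<beta> \<ge> 0" "\<gamma> \<ge> 0" "\<alpha> + \<beta> + \<gamma> > 0"
  shows "(\<alpha> + \<beta> + \<gamma>) *\<^sub>R v \<noteq> \<alpha> *\<^sub>R x + \<beta> *\<^sub>R y + \<gamma> *\<^sub>R z"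
proof
  let ?s = "\<alpha> + \<beta> + \<gamma>"
  assume "?s *\<^sub>R v = \<alpha> *\<^sub>R x + \<beta> *\<^sub>R y + \<gamma> *\<^sub>R z"
  then have "(1 / ?s) *\<^sub>R (?s *\<^sub>R v) = (1 / ?s) *\<^sub>R (\<alpha> *\<^sub>R x + \<beta> *\<^sub>R y + \<gamma> *\<^sub>R z)" by simp
  then have "v = (\<alpha> / ?s) *\<^sub>R x + (\<beta> / ?s) *\<^sub>R y + (\<gamma> / ?s) *\<^sub>R z"
    using w by (simp add: scaleR_add_right)
  moreover have "\<alpha> / ?s + \<beta> / ?s + \<gamma> / ?s = 1" using w by (simp add: add_divide_distrib[symmetric])
  moreover have "0 \<le> \<alpha> / ?s" "0 \<le> \<beta> / ?s" "0 \<le> \<gamma> / ?s" using w by auto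
  ultimately have "v \<in> convex hull {x, y, z}" unfolding convex_hull_3 by blast
  moreover have sub: "convex hull {x, y, z} \<subseteq> P" using xyz P by (intro hull_minimal) auto
  ultimately have "v extreme_point_of (convex hull {x, y, z})"
    using v by (auto simp: extreme_point_of_def subset_iff)
  then show False using extreme_point_of_convex_hull xyz by blast
qed

text \<open>Of three collinear points one lies strictly between the other two; the parameter
  \<open>t\<close> tells which. The third point may be a vertex or the puncture.\<close>

lemma extreme_point_orient_nonzero:
  assumes P: "convex P" and a: "a extreme_point_of P" and b: "b extreme_point_of P"
    and c: "c extreme_point_of P \<or> c \<in> interior P \<and> c \<notin> open_segment a b"
    and ne: "a \<noteq> b" "a \<noteq> c" "b \<noteq> c"
  shows "orient a b c \<noteq> 0"
proof
  assume "orient a b c = 0"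
  then obtain t where t: "c = (1 - t) *\<^sub>R a + t *\<^sub>R b" using orient_0_imp_affine ne by metis
  have in_P: "a \<in> P" "b \<in> P" "c \<in> P" using a b c interior_subset by (auto simp: extreme_point_of_def)
  consider "t < 0" | "t > 1" | "0 \<le> t" "t \<le> 1" by linarith
  then show False
  proof cases
    case 1
    have "(1 + - t + 0) *\<^sub>R a = 1 *\<^sub>R c + (- t) *\<^sub>R b + 0 *\<^sub>R b" unfolding t by (simp add: algebra_simps)
    then show False using extreme_point_not_weighted[OF P a, of c b b 1 "- t" 0] 1 ne in_P by auto
  next
    case 2
    have "(1 + (t - 1) + 0) *\<^sub>R b = 1 *\<^sub>R c + (t - 1) *\<^sub>R a + 0 *\<^sub>R a" unfolding t by (simp add: algebra_simps)
    then show False using extreme_point_not_weighted[OF P b, of c a a 1 "t - 1" 0] 2 ne in_P by auto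
  next
    case 3
    then have "c \<in> open_segment a b" using t ne by (auto simp: open_segment_def in_segment)
    then show False using c in_P by (auto simp: extreme_point_of_def)
  qed
qed

text \<open>Otherwise \<open>v\<close> would be a weighted mean of \<open>x\<close>,
  \<open>y\<close>, \<open>z\<close>. So the points of \<open>P\<close> seen from an extreme point
  are ordered by angle without going round. The weak inequality admits \<open>z\<close> on the ray
  through \<open>y\<close>.\<close>

lemma extreme_point_wedge:
  assumes P: "convex P" and v: "v extreme_point_of P" and xyz: "{x, y, z} \<subseteq> P - {v}"
    and xy: "orient v x y > 0" and yz: "orient v y z \<ge> 0"
  shows "orient v x z > 0"
proof (rule ccontr)
  assume "\<not> ?thesis"
  then have xz: "orient x v z \<ge> 0" using orient_swap[of v x z] by simp
  have "orient x y v > 0" using xy orient_rotate by simp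
  then have "(orient v y z + orient x v z + orient x y v) *\<^sub>R v
      \<noteq> orient v y z *\<^sub>R x + orient x v z *\<^sub>R y + orient x y v *\<^sub>R z"
    using xz yz by (intro extreme_point_not_weighted[OF P v xyz]) auto
  then show False using orient_barycentric[of x y z v] unfolding orient_barycentric_sum by simp
qed

text \<open>Seen from \<open>v\<close>, the point \<open>y\<close> lies between \<open>x\<close> and
  \<open>z\<close>; if it were not strictly beyond the segment joining them, it would lie in the
  triangle on \<open>v\<close>, \<open>x\<close>, \<open>z\<close>.\<close>

lemma extreme_point_triple:
  assumes P: "convex P" and y: "y extreme_point_of P" and oxz: "{v, x, z} \<subseteq> P - {y}"
    and xy: "orient v x y > 0" and yz: "orient v y z > 0"
  shows "orient x y z > 0"
proof (rule ccontr)
  assume "\<not> ?thesis"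
  then have 1: "orient y x z \<ge> 0" using orient_swap[of x y z] by simp
  have "(orient y x z + orient v y z + orient v x y) *\<^sub>R y
      \<noteq> orient y x z *\<^sub>R v + orient v y z *\<^sub>R x + orient v x y *\<^sub>R z"
    using 1 xy yz by (intro extreme_point_not_weighted[OF P y oxz]) auto
  then show False using orient_barycentric[of v x z y] unfolding orient_barycentric_sum by simp
qed

text \<open>Elements are ranked by their number of predecessors, which is injective and stays below
  the cardinality; the enumeration inverts the rank.\<close>

lemma enumerate_strict_total_order:
  assumes W: "finite W" and irrefl: "\<And>x. \<not> r x x"
    and total: "\<And>x y. x \<in> W \<Longrightarrow> y \<in> W \<Longrightarrow> x \<noteq> y \<Longrightarrow> r x y \<or> r y x"
    and trans: "\<And>x y z. x \<in> W \<Longrightarrow> y \<in> W \<Longrightarrow> z \<in> W \<Longrightarrow> r x y \<Longrightarrow> r y z \<Longrightarrow> r x z"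
  obtains f where "bij_betw f {..<card W} W" "\<And>i j. i < j \<Longrightarrow> j < card W \<Longrightarrow> r (f i) (f j)"
proof -
  define g where "g x = card {y \<in> W. r y x}" for x
  have less: "g x < g y" if "x \<in> W" "y \<in> W" "r x y" for x y
  proof -
    have "{w \<in> W. r w x} \<subset> {w \<in> W. r w y}" using that irrefl trans by blast
    then show ?thesis unfolding g_def by (intro psubset_card_mono) (use W in auto)
  qed
  have inj: "inj_on g W" using less total by (metis inj_onI less_irrefl)
  have "g x < card W" if "x \<in> W" for x
    unfolding g_def by (rule psubset_card_mono[OF W]) (use that irrefl in blast)
  then have "g ` W = {..<card W}"
    by (intro card_subset_eq) (auto simp: card_image[OF inj])
  then have bij: "bij_betw g W {..<card W}" using inj by (simp add: bij_betw_def)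
  let ?f = "inv_into W g"
  have f: "bij_betw ?f {..<card W} W" using bij by (rule bij_betw_inv_into)
  show ?thesis
  proof (rule that[OF f])
    fix i j assume ij: "i < j" "j < card W"
    then have in_W: "?f i \<in> W" "?f j \<in> W" using f by (auto simp: bij_betw_def)
    have "g (?f i) = i" "g (?f j) = j" using ij bij by (auto intro: bij_betw_inv_into_right)
    then show "r (?f i) (?f j)" using total[OF in_W] less[OF in_W(2,1)] ij by fastforce
  qed
qed

section \<open>Labelled convex polygons\<close>

text \<open>Orientation is required of all increasing triples, not just consecutive ones, so that
  the side of any vertex relative to any chord can be read off the indices.\<close>

locale polygon_labelling =
  fixes n :: nat and \<nu> :: "nat \<Rightarrow> real^2" and P :: "(real^2) set"
  assumes n3: "n \<ge> 3"
    and ccw: "i < j \<Longrightarrow> j < k \<Longrightarrow> k < n \<Longrightarrow> orient (\<nu> i) (\<nu> j) (\<nu> k) > 0"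
    and hull: "P = convex hull (\<nu> ` {..<n})"
    and extreme: "i < n \<Longrightarrow> \<nu> i extreme_point_of P"
begin

lemma convex_P: "convex P"
  by (simp add: hull convex_convex_hull)

lemma vertex_in: "i < n \<Longrightarrow> \<nu> i \<in> P"
  using extreme by (auto simp: extreme_point_of_def)

lemma orient_pos: "i < j \<Longrightarrow> j < n \<Longrightarrow> k < n \<Longrightarrow> k < i \<or> j < k \<Longrightarrow> orient (\<nu> i) (\<nu> j) (\<nu> k) > 0"
  using ccw orient_rotate by metis

lemma orient_neg: "i < k \<Longrightarrow> k < j \<Longrightarrow> j < n \<Longrightarrow> orient (\<nu> i) (\<nu> j) (\<nu> k) < 0"
  using ccw[of i k j] orient_swap'[of "\<nu> i" "\<nu> j" "\<nu> k"] by simp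

lemma orient_nonneg: "i < j \<Longrightarrow> j < n \<Longrightarrow> k < n \<Longrightarrow> k \<le> i \<or> j \<le> k \<Longrightarrow> orient (\<nu> i) (\<nu> j) (\<nu> k) \<ge> 0"
  using orient_pos[of i j k] by (cases "k = i \<or> k = j") auto

lemma vertex_less_neq: "i < j \<Longrightarrow> j < n \<Longrightarrow> \<nu> i \<noteq> \<nu> j"
proof
  assume ij: "i < j" "j < n" and eq: "\<nu> i = \<nu> j"
  have "\<exists>k<n. k \<noteq> i \<and> k \<noteq> j"
    using n3 by (metis One_nat_def lessI less_trans not_less_eq numeral_3_eq_3 order_less_le_trans zero_less_Suc n_not_Suc_n)
  then obtain k where "k < n" "k \<noteq> i" "k \<noteq> j" by blast
  then have "orient (\<nu> i) (\<nu> j) (\<nu> k) \<noteq> 0"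
    using orient_pos[of i j k] orient_neg[of i k j] ij by (metis less_irrefl linorder_neqE_nat)
  then show False using eq by simp
qed

lemma vertex_eq_iff: "i < n \<Longrightarrow> j < n \<Longrightarrow> \<nu> i = \<nu> j \<longleftrightarrow> i = j"
  using vertex_less_neq by (metis linorder_neqE_nat)

lemma inj_on_vertices: "inj_on \<nu> {..<n}"
  using vertex_eq_iff by (auto intro: inj_onI)

text \<open>Crossing chords have each other's ends on opposite sides. If the indices do not
  interleave, one of the chords has both ends of the other on its nonnegative side, and not both on
  its line, since the chords differ.\<close>

lemma open_segments_meet_iff:
  assumes ij: "i < j" "j < n" and kl: "k < l" "l < n" and ne: "(i, j) \<noteq> (k, l)"
  shows "open_segment (\<nu> i) (\<nu> j) \<inter> open_segment (\<nu> k) (\<nu> l) \<noteq> {} \<longleftrightarrow> crosses i j k l"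
proof
  assume "crosses i j k l"
  then consider "i < k" "k < j" "j < l" | "k < i" "i < l" "l < j" by (auto simp: crosses_def)
  then show "open_segment (\<nu> i) (\<nu> j) \<inter> open_segment (\<nu> k) (\<nu> l) \<noteq> {}"
  proof cases
    case 1
    have "open_segment (\<nu> i) (\<nu> j) \<inter> open_segment (\<nu> l) (\<nu> k) \<noteq> {}"
    proof (rule open_segments_meet)
      show "orient (\<nu> i) (\<nu> j) (\<nu> l) > 0" "orient (\<nu> i) (\<nu> j) (\<nu> k) < 0"
        using 1 kl orient_pos[of i j l] orient_neg[of i k j] by auto
      show "orient (\<nu> l) (\<nu> k) (\<nu> i) < 0" "orient (\<nu> l) (\<nu> k) (\<nu> j) > 0"
        using 1 kl orient_pos[of k l i] orient_neg[of k j l]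
          orient_swap[of "\<nu> k" "\<nu> l" "\<nu> i"] orient_swap[of "\<nu> k" "\<nu> l" "\<nu> j"] by auto
    qed
    then show ?thesis by (simp add: open_segment_commute)
  next
    case 2
    have "open_segment (\<nu> i) (\<nu> j) \<inter> open_segment (\<nu> k) (\<nu> l) \<noteq> {}"
    proof (rule open_segments_meet)
      show "orient (\<nu> i) (\<nu> j) (\<nu> k) > 0" "orient (\<nu> i) (\<nu> j) (\<nu> l) < 0"
        using 2 ij orient_pos[of i j k] orient_neg[of i l j] by auto
      show "orient (\<nu> k) (\<nu> l) (\<nu> i) < 0" "orient (\<nu> k) (\<nu> l) (\<nu> j) > 0"
        using 2 ij orient_pos[of k l j] orient_neg[of k i l] by auto
    qed
    then show ?thesis .
  qed
next
  assume meet: "open_segment (\<nu> i) (\<nu> j) \<inter> open_segment (\<nu> k) (\<nu> l) \<noteq> {}"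
  show "crosses i j k l"
  proof (rule ccontr)
    assume nc: "\<not> crosses i j k l"
    have "k < n" "i < n" using ij kl by auto
    then consider "k \<le> i \<or> j \<le> k" "l \<le> i \<or> j \<le> l" | "i \<le> k" "k \<le> j" "i \<le> l" "l \<le> j"
      using nc ij kl unfolding crosses_def by linarith
    then show False
    proof cases
      case 1
      then have "orient (\<nu> i) (\<nu> j) (\<nu> k) \<ge> 0" "orient (\<nu> i) (\<nu> j) (\<nu> l) \<ge> 0"
        using orient_nonneg ij kl \<open>k < n\<close> by auto
      moreover have "orient (\<nu> i) (\<nu> j) (\<nu> k) \<noteq> 0 \<or> orient (\<nu> i) (\<nu> j) (\<nu> l) \<noteq> 0"
      proof (cases "k = i \<or> k = j")
        case True
        then have "l < i \<or> j < l" using 1 ne kl ij by auto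
        then show ?thesis using orient_pos[of i j l] ij kl by auto
      next
        case False
        then have "k < i \<or> j < k" using 1 by auto
        then show ?thesis using orient_pos[of i j k] ij \<open>k < n\<close> by auto
      qed
      ultimately show False using open_segments_disjoint meet by blast
    next
      case 2
      then have "orient (\<nu> k) (\<nu> l) (\<nu> i) \<ge> 0" "orient (\<nu> k) (\<nu> l) (\<nu> j) \<ge> 0"
        using orient_nonneg ij kl \<open>i < n\<close> by auto
      moreover have "orient (\<nu> k) (\<nu> l) (\<nu> i) \<noteq> 0 \<or> orient (\<nu> k) (\<nu> l) (\<nu> j) \<noteq> 0"
      proof (cases "i = k")
        case True
        then have "l < j" using 2 ne by auto
        then show ?thesis using orient_pos[of k l j] ij kl by auto
      next
        case False
        then show ?thesis using orient_pos[of k l i] 2 \<open>i < n\<close> kl by auto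
      qed
      ultimately show False using open_segments_disjoint meet by blast
    qed
  qed
qed

lemma polygon_vertices_P: "polygon_vertices P = \<nu> ` {..<n}"
  using extreme extreme_point_of_convex_hull[of _ "\<nu> ` {..<n}"]
  by (auto simp: polygon_vertices_def hull[symmetric])

text \<open>Any vertex may serve as vertex 0. The indices that wrap around form a final part of an
  increasing triple, so the triple is only permuted cyclically.\<close>

lemma rotate:
  assumes r: "r < n"
  shows "polygon_labelling n (\<lambda>i. \<nu> ((i + r) mod n)) P"
proof
  have m: "(i + r) mod n = (if i + r < n then i + r else i + r - n)" if "i < n" for i
    using that r by (simp add: mod_if)
  show "n \<ge> 3" by (rule n3)
  show "orient (\<nu> ((i + r) mod n)) (\<nu> ((j + r) mod n)) (\<nu> ((k + r) mod n)) > 0"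
    if "i < j" "j < k" "k < n" for i j k
  proof -
    have lt: "i < n" "j < n" using that by auto
    consider "k + r < n" | "j + r < n" "\<not> k + r < n" | "i + r < n" "\<not> j + r < n" | "\<not> i + r < n"
      using that by linarith
    then show ?thesis
    proof cases
      case 1
      then show ?thesis using ccw[of "i + r" "j + r" "k + r"] that lt by (simp add: m)
    next
      case 2
      then have "orient (\<nu> (k + r - n)) (\<nu> (i + r)) (\<nu> (j + r)) > 0" using ccw that r by simp
      then show ?thesis using orient_rotate 2 that lt by (simp add: m)
    next
      case 3
      then have "orient (\<nu> (j + r - n)) (\<nu> (k + r - n)) (\<nu> (i + r)) > 0" using ccw that r by simp
      then have "orient (\<nu> (i + r)) (\<nu> (j + r - n)) (\<nu> (k + r - n)) > 0" by (metis orient_rotate)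
      then show ?thesis using 3 that lt by (simp add: m)
    next
      case 4
      then show ?thesis using ccw[of "i + r - n" "j + r - n" "k + r - n"] that lt r by (simp add: m)
    qed
  qed
  have "(\<lambda>i. (i + r) mod n) ` {..<n} = {..<n}"
  proof (rule card_subset_eq)
    show "card ((\<lambda>i. (i + r) mod n) ` {..<n}) = card {..<n}"
      by (rule card_image, rule inj_onI) (use r in \<open>auto simp: m split: if_splits\<close>)
  qed (use n3 in auto)
  then have "(\<lambda>i. \<nu> ((i + r) mod n)) ` {..<n} = \<nu> ` {..<n}" by (metis image_image)
  then show "P = convex hull ((\<lambda>i. \<nu> ((i + r) mod n)) ` {..<n})" using hull by simp
  show "\<nu> ((i + r) mod n) extreme_point_of P" if "i < n" for i using extreme n3 by simp
qed

end

text \<open>One vertex is numbered 0 and the others are sorted by angle around it.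
  \<open>extreme_point_wedge\<close> gives transitivity, \<open>extreme_point_triple\<close> the
  orientation of triples that avoid it.\<close>

lemma convex_polygon_imp_labelling:
  assumes "convex_polygon n P"
  obtains \<nu> where "polygon_labelling n \<nu> P"
proof -
  let ?V = "polygon_vertices P"
  have P: "polytope P" "aff_dim P = 2" "card ?V = n" using assms by (auto simp: convex_polygon_def)
  have conv: "convex P" using P polytope_imp_convex by blast
  have hull: "P = convex hull ?V"
    unfolding polygon_vertices_def
    using Krein_Milman_Minkowski P(1) polytope_imp_compact polytope_imp_convex by blast
  obtain S where "finite S" "P = convex hull S" using P(1) by (auto simp: polytope_def)
  then have fin: "finite ?V"
    using extreme_point_of_convex_hull[of _ S] finite_subset[of ?V S] by (auto simp: polygon_vertices_def)
  have "aff_dim ?V = 2" using P(2) hull aff_dim_convex_hull[of ?V] by simp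
  then have n3: "n \<ge> 3" using aff_dim_le_card[OF fin] P(3) by linarith
  then obtain v where v: "v \<in> ?V" using P(3) by (metis card.empty ex_in_conv not_numeral_le_zero)
  have ext: "x extreme_point_of P" if "x \<in> ?V" for x using that by (simp add: polygon_vertices_def)
  have in_P: "x \<in> P" if "x \<in> ?V" for x using ext[OF that] by (auto simp: extreme_point_of_def)
  let ?W = "?V - {v}"
  have cW: "card ?W = n - 1" using v fin P(3) by simp
  obtain f where f: "bij_betw f {..<card ?W} ?W"
    and fless: "\<And>i j. i < j \<Longrightarrow> j < card ?W \<Longrightarrow> orient v (f i) (f j) > 0"
  proof (rule enumerate_strict_total_order[of ?W "\<lambda>x y. orient v x y > 0"])
    show "finite ?W" using fin by simp
    show "\<not> orient v x x > 0" for x by simp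
    show "orient v x y > 0 \<or> orient v y x > 0" if "x \<in> ?W" "y \<in> ?W" "x \<noteq> y" for x y
      using extreme_point_orient_nonzero[OF conv ext ext, of v x y] orient_swap'[of v x y] that v ext[of y] by auto
    show "orient v x z > 0" if "x \<in> ?W" "y \<in> ?W" "z \<in> ?W" "orient v x y > 0" "orient v y z > 0" for x y z
      using extreme_point_wedge[OF conv ext[OF v], of x y z] that in_P by auto
  qed blast
  define \<nu> where "\<nu> i = (if i = 0 then v else f (i - 1))" for i
  have "\<nu> ` {..<n} = ?V"
  proof -
    have "{..<n} = insert 0 (Suc ` {..<n - 1})" using n3 lessThan_Suc_eq_insert_0[of "n - 1"] by simp
    then have "\<nu> ` {..<n} = insert (\<nu> 0) ((\<lambda>i. \<nu> (Suc i)) ` {..<n - 1})"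
      by (simp only: image_insert image_image)
    also have "\<dots> = insert v (f ` {..<n - 1})" by (simp add: \<nu>_def)
    also have "f ` {..<n - 1} = ?W" using f cW by (simp add: bij_betw_def)
    finally show ?thesis using v by auto
  qed
  note V = this
  have "polygon_labelling n \<nu> P"
  proof
    show "n \<ge> 3" by (rule n3)
    show "P = convex hull (\<nu> ` {..<n})" using V hull by simp
    show "\<nu> i extreme_point_of P" if "i < n" for i using V ext that by blast
    show "orient (\<nu> i) (\<nu> j) (\<nu> k) > 0" if ijk: "i < j" "j < k" "k < n" for i j k
    proof -
      have jk: "orient v (\<nu> j) (\<nu> k) > 0" using fless[of "j - 1" "k - 1"] ijk cW by (auto simp: \<nu>_def)
      show ?thesis
      proof (cases "i = 0")
        case True then show ?thesis using jk by (simp add: \<nu>_def)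
      next
        case False
        have ij: "orient v (\<nu> i) (\<nu> j) > 0" using fless[of "i - 1" "j - 1"] ijk cW False by (auto simp: \<nu>_def)
        have "\<nu> i \<in> ?V" "\<nu> j \<in> ?V" "\<nu> k \<in> ?V" using V ijk by auto
        moreover have "\<nu> j \<noteq> \<nu> i" "\<nu> j \<noteq> \<nu> k" "\<nu> j \<noteq> v" using ij jk by auto
        ultimately show ?thesis
          using extreme_point_triple[OF conv ext, of "\<nu> j" v "\<nu> i" "\<nu> k"] ij jk v in_P by auto
      qed
    qed
  qed
  then show ?thesis by (rule that)
qed

section \<open>The puncture relative to chords and spokes\<close>

locale punctured_labelling = polygon_labelling +
  fixes p :: "real^2"
  assumes p: "p \<in> interior P"
begin

abbreviation \<sigma> :: "nat \<Rightarrow> nat \<Rightarrow> real" where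
  "\<sigma> i j \<equiv> orient (\<nu> i) (\<nu> j) p"

lemma p_in: "p \<in> P"
  using p interior_subset by blast

lemma p_not_vertex: "i < n \<Longrightarrow> p \<noteq> \<nu> i"
  using extreme p extreme_point_not_in_interior by blast

lemma wedge:
  assumes "i < n" "x < n" "y < n" "orient (\<nu> i) (\<nu> x) (\<nu> y) > 0" "\<sigma> i y \<ge> 0"
  shows "\<sigma> i x > 0"
proof -
  have "\<nu> x \<noteq> \<nu> i" "\<nu> y \<noteq> \<nu> i" "p \<noteq> \<nu> i" using assms p_not_vertex by auto
  then show ?thesis
    using extreme_point_wedge[OF convex_P extreme, of i "\<nu> x" "\<nu> y" p] vertex_in p_in assms by auto
qed

lemma puncture_on_chord_iff:
  assumes "i < j" "j < n"
  shows "p \<in> open_segment (\<nu> i) (\<nu> j) \<longleftrightarrow> \<sigma> i j = 0"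
proof
  assume "\<sigma> i j = 0"
  then show "p \<in> open_segment (\<nu> i) (\<nu> j)"
    using extreme_point_orient_nonzero[OF convex_P extreme extreme, of i j p] assms p vertex_less_neq[OF assms]
      p_not_vertex[of i] p_not_vertex[of j] by auto
qed (rule in_open_segment_orient_0)

text \<open>The puncture and vertex \<open>s\<close> lie on opposite sides of the chord by
  assumption; the angular orders at \<open>i\<close> and at \<open>j\<close> put these two on
  opposite sides of the spoke. The indices are not assumed ordered, so exchanging \<open>i\<close>
  and \<open>j\<close> covers both signs of a chord.\<close>

lemma spoke_crosses_aux:
  assumes lt: "i < n" "j < n" "s < n" and "orient (\<nu> i) (\<nu> s) (\<nu> j) > 0" and "\<sigma> i j > 0"
  shows "open_segment (\<nu> i) (\<nu> j) \<inter> open_segment p (\<nu> s) \<noteq> {}"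
proof (rule open_segments_meet)
  show "\<sigma> i j > 0" by fact
  show "orient (\<nu> i) (\<nu> j) (\<nu> s) < 0" using assms orient_swap'[of "\<nu> i" "\<nu> j" "\<nu> s"] by simp
  have "\<sigma> i s > 0" using wedge[of i s j] assms by simp
  then show "orient p (\<nu> s) (\<nu> i) < 0"
    using orient_rotate[of p "\<nu> s" "\<nu> i"] orient_swap'[of "\<nu> i" p "\<nu> s"] by simp
  have "\<sigma> j i < 0" using assms(5) orient_swap[of "\<nu> i" "\<nu> j" p] by simp
  moreover have "orient (\<nu> j) (\<nu> i) (\<nu> s) > 0" using assms(4) orient_rotate by metis
  ultimately have "\<sigma> j s < 0" using wedge[of j i s] lt by force
  then show "orient p (\<nu> s) (\<nu> j) > 0"
    using orient_rotate[of p "\<nu> s" "\<nu> j"] orient_swap'[of "\<nu> j" p "\<nu> s"] by simp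
qed

lemma spoke_meets_iff:
  assumes ij: "i < j" "j < n" and s: "s < n" and nz: "\<sigma> i j \<noteq> 0"
  shows "open_segment (\<nu> i) (\<nu> j) \<inter> open_segment p (\<nu> s) \<noteq> {} \<longleftrightarrow> spoke_crosses \<sigma> s i j"
proof
  assume "spoke_crosses \<sigma> s i j"
  then consider "\<sigma> i j > 0" "i < s" "s < j" | "\<sigma> i j < 0" "s < i \<or> j < s"
    by (auto simp: spoke_crosses_def)
  then show "open_segment (\<nu> i) (\<nu> j) \<inter> open_segment p (\<nu> s) \<noteq> {}"
  proof cases
    case 1
    then show ?thesis using spoke_crosses_aux[of i j s] ccw[of i s j] ij s by simp
  next
    case 2
    have "orient (\<nu> j) (\<nu> s) (\<nu> i) > 0" using orient_pos[of i j s] ij s 2 orient_rotate by metis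
    moreover have "\<sigma> j i > 0" using 2 orient_swap[of "\<nu> i" "\<nu> j" p] by simp
    ultimately show ?thesis using spoke_crosses_aux[of j i s] ij s by (simp add: open_segment_commute)
  qed
next
  assume meet: "open_segment (\<nu> i) (\<nu> j) \<inter> open_segment p (\<nu> s) \<noteq> {}"
  show "spoke_crosses \<sigma> s i j"
  proof (rule ccontr)
    assume nc: "\<not> spoke_crosses \<sigma> s i j"
    consider "\<sigma> i j > 0" | "\<sigma> i j < 0" using nz by linarith
    then show False
    proof cases
      case 1
      then have "s \<le> i \<or> j \<le> s" using nc by (auto simp: spoke_crosses_def)
      then show False
        using open_segments_disjoint[of "\<nu> i" "\<nu> j" p "\<nu> s"] orient_nonneg[of i j s] ij s 1 meet by auto
    next
      case 2
      then have "i \<le> s" "s \<le> j" using nc by (auto simp: spoke_crosses_def)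
      then have "orient (\<nu> j) (\<nu> i) (\<nu> s) \<ge> 0"
        using orient_neg[of i s j] ij orient_swap[of "\<nu> i" "\<nu> j" "\<nu> s"] by (cases "s = i \<or> s = j") auto
      moreover have "\<sigma> j i > 0" using 2 orient_swap[of "\<nu> i" "\<nu> j" p] by simp
      ultimately show False
        using open_segments_disjoint[of "\<nu> j" "\<nu> i" p "\<nu> s"] meet by (auto simp: open_segment_commute)
    qed
  qed
qed

text \<open>A common point would put both vertices on one ray from the puncture, with the nearer one
  between the puncture and the farther. In the auxiliary claim, \<open>w \<le> u\<close> says that
  vertex \<open>s\<close> is the nearer.\<close>

lemma spokes_disjoint:
  assumes "s < n" "t < n" "s \<noteq> t"
  shows "open_segment p (\<nu> s) \<inter> open_segment p (\<nu> t) = {}"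
proof (rule ccontr)
  have *: False if st: "s < n" "t < n" "s \<noteq> t" and u: "0 < u" and w: "0 \<le> w" "w \<le> u"
    and eq: "(1 - u) *\<^sub>R p + u *\<^sub>R \<nu> s = (1 - w) *\<^sub>R p + w *\<^sub>R \<nu> t" for s t u w
  proof -
    have 1: "(w + (u - w) + 0) *\<^sub>R \<nu> s = w *\<^sub>R \<nu> t + (u - w) *\<^sub>R p + 0 *\<^sub>R p"
    proof -
      have "u *\<^sub>R \<nu> s = (1 - w) *\<^sub>R p + w *\<^sub>R \<nu> t - (1 - u) *\<^sub>R p" using eq by (metis add_diff_cancel_left')
      also have "\<dots> = w *\<^sub>R \<nu> t + (u - w) *\<^sub>R p" by (simp add: scaleR_left_diff_distrib)
      finally show ?thesis by simp
    qed
    have 2: "{\<nu> t, p, p} \<subseteq> P - {\<nu> s}"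
      using st vertex_in[of t] p_in p_not_vertex[of s] vertex_eq_iff[of s t] by auto
    have 3: "0 \<le> u - w" "0 < w + (u - w) + 0" using u w by auto
    show False
      using extreme_point_not_weighted[OF convex_P extreme[OF st(1)] 2 w(1) 3(1) order_refl 3(2)] 1 by contradiction
  qed
  assume "\<not> ?thesis"
  then obtain z where z: "z \<in> open_segment p (\<nu> s)" "z \<in> open_segment p (\<nu> t)" by blast
  obtain u where u: "0 < u" "z = (1 - u) *\<^sub>R p + u *\<^sub>R \<nu> s" using z(1) unfolding in_segment by blast
  obtain w where w: "0 < w" "z = (1 - w) *\<^sub>R p + w *\<^sub>R \<nu> t" using z(2) unfolding in_segment by blast
  have uw: "0 < u" "0 < w" "(1 - u) *\<^sub>R p + u *\<^sub>R \<nu> s = (1 - w) *\<^sub>R p + w *\<^sub>R \<nu> t" using u w by simp_all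
  show False
  proof (cases "w \<le> u")
    case True
    then show False using *[OF assms uw(1) _ _ uw(3)] uw(2) by linarith
  next
    case False
    then show False using *[OF assms(2,1) assms(3)[symmetric] uw(2) _ _ uw(3)[symmetric]] uw(1) by linarith
  qed
qed

end

section \<open>Triangulations of labelled polygons\<close>

text \<open>Non-crossing is a pairwise condition, so maximality can be tested by adding a single
  arc. This is the form that matches the definitions on indices.\<close>

lemma triangulations_iff:
  "T \<in> triangulations M \<longleftrightarrow> T \<subseteq> segment_arcs M \<and>
     (\<forall>a\<in>T. \<forall>b\<in>T. a \<noteq> b \<longrightarrow> rel_interior a \<inter> rel_interior b = {}) \<and>
     (\<forall>a\<in>segment_arcs M. (\<forall>b\<in>T. a \<noteq> b \<longrightarrow> rel_interior a \<inter> rel_interior b = {}) \<longrightarrow> a \<in> T)"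
  (is "_ \<longleftrightarrow> ?sub \<and> ?nc \<and> ?mx")
proof -
  have nc_iff: "non_crossing S \<longleftrightarrow> (\<forall>a\<in>S. \<forall>b\<in>S. a \<noteq> b \<longrightarrow> rel_interior a \<inter> rel_interior b = {})" for S
    by (simp add: non_crossing_def pairwise_def)
  show ?thesis
  proof
    assume T: "T \<in> triangulations M"
    then have 1: "?sub" "?nc" by (auto simp: triangulations_def nc_iff)
    have ?mx
    proof (intro ballI impI)
      fix a assume a: "a \<in> segment_arcs M" "\<forall>b\<in>T. a \<noteq> b \<longrightarrow> rel_interior a \<inter> rel_interior b = {}"
      then have "non_crossing (insert a T)" unfolding nc_iff using 1(2) by fast
      then have "insert a T = T" using T a 1 by (auto simp: triangulations_def)
      then show "a \<in> T" by blast
    qed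
    then show "?sub \<and> ?nc \<and> ?mx" using 1 by blast
  next
    assume *: "?sub \<and> ?nc \<and> ?mx"
    have "T' = T" if sub: "T \<subseteq> T'" "T' \<subseteq> segment_arcs M" and nc: "non_crossing T'" for T'
    proof (rule subset_antisym[OF _ sub(1)], rule subsetI)
      fix a assume a: "a \<in> T'"
      have "rel_interior a \<inter> rel_interior b = {}" if "b \<in> T" "a \<noteq> b" for b
        using nc a sub(1) that unfolding nc_iff by (metis subsetD)
      moreover have "a \<in> segment_arcs M" using a sub(2) by (rule subsetD[rotated])
      ultimately show "a \<in> T" using * by simp
    qed
    moreover have "non_crossing T" using * nc_iff[of T] by simp
    ultimately show "T \<in> triangulations M" using * unfolding triangulations_def by simp
  qed
qed

lemma triangulations_eqI:
  "T \<in> triangulations M \<Longrightarrow> U \<in> triangulations M \<Longrightarrow> T \<subseteq> U \<Longrightarrow> T = U"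
  by (auto simp: triangulations_def)

text \<open>By maximality neither triangulation properly contains the other, so the two differences
  are both empty or both nonempty, and then of size exactly one.\<close>

lemma equal_or_flip:
  assumes "T \<in> triangulations M" "U \<in> triangulations M"
    and "\<And>x y. x \<in> T - U \<Longrightarrow> y \<in> T - U \<Longrightarrow> x = y" "\<And>x y. x \<in> U - T \<Longrightarrow> y \<in> U - T \<Longrightarrow> x = y"
  shows "T = U \<or> (T, U) \<in> parcs (flip_graph M)"
proof (cases "T - U = {} \<or> U - T = {}")
  case True
  then show ?thesis using triangulations_eqI[OF assms(1,2)] triangulations_eqI[OF assms(2,1)] by blast
next
  case False
  then obtain x y where xy: "x \<in> T - U" "y \<in> U - T" by blast
  then have "T - U = {x}" "U - T = {y}" using assms(3)[of _ x] assms(4)[of _ y] by blast+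
  then show ?thesis using assms by (simp add: flip_graph_def)
qed

context polygon_labelling
begin

definition chord :: "nat \<Rightarrow> nat \<Rightarrow> (real^2) set" where
  "chord i j = closed_segment (\<nu> i) (\<nu> j)"

definition chord_rel :: "(real^2) set set \<Rightarrow> nat \<Rightarrow> nat \<Rightarrow> bool" where
  "chord_rel T i j \<longleftrightarrow> i < j \<and> j < n \<and> chord i j \<in> T"

definition chord_set :: "(nat \<Rightarrow> nat \<Rightarrow> bool) \<Rightarrow> (real^2) set set" where
  "chord_set R = {chord i j | i j. i < j \<and> j < n \<and> R i j}"

lemma chord_commute: "chord i j = chord j i"
  by (simp add: chord_def closed_segment_commute)

lemma chord_eq_iff:
  assumes "i < j" "j < n" "k < l" "l < n"
  shows "chord i j = chord k l \<longleftrightarrow> i = k \<and> j = l"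
  using vertex_eq_iff[of i k] vertex_eq_iff[of i l] vertex_eq_iff[of j k] vertex_eq_iff[of j l] assms
  by (auto simp: chord_def doubleton_eq_iff)

lemma rel_interior_chord: "i < j \<Longrightarrow> j < n \<Longrightarrow> rel_interior (chord i j) = open_segment (\<nu> i) (\<nu> j)"
  using vertex_less_neq by (simp add: chord_def rel_interior_closed_segment)

lemma vertex_not_in_open_segment: "x \<in> P \<Longrightarrow> y \<in> P \<Longrightarrow> v \<in> polygon_vertices P \<Longrightarrow> v \<notin> open_segment x y"
  by (auto simp: polygon_vertices_def extreme_point_of_def)

lemma segment_arcs_vertices:
  "segment_arcs (polygon_vertices P) = {chord i j | i j. i < j \<and> j < n}"
proof (intro set_eqI iffI)
  fix e assume "e \<in> segment_arcs (polygon_vertices P)"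
  then obtain i j where ij: "e = chord i j" "i < n" "j < n" "i \<noteq> j"
    by (auto simp: segment_arcs_def polygon_vertices_P chord_def)
  then show "e \<in> {chord i j | i j. i < j \<and> j < n}"
    by (cases "i < j") (use chord_commute in force)+
next
  fix e assume "e \<in> {chord i j | i j. i < j \<and> j < n}"
  then obtain i j where ij: "e = chord i j" "i < j" "j < n" by blast
  then have "open_segment (\<nu> i) (\<nu> j) \<inter> polygon_vertices P = {}"
    using vertex_not_in_open_segment vertex_in[of i] vertex_in[of j] by auto
  moreover have "\<nu> i \<in> polygon_vertices P" "\<nu> j \<in> polygon_vertices P" using ij by (auto simp: polygon_vertices_P)
  ultimately show "e \<in> segment_arcs (polygon_vertices P)"
    using ij vertex_less_neq[of i j] unfolding segment_arcs_def chord_def by blast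
qed

lemma chord_set_chord_rel:
  "T \<subseteq> segment_arcs (polygon_vertices P) \<Longrightarrow> chord_set (chord_rel T) = T"
  unfolding segment_arcs_vertices chord_set_def chord_rel_def by blast

lemma chord_rel_chord_set:
  "(\<And>i j. R i j \<Longrightarrow> i < j \<and> j < n) \<Longrightarrow> chord_rel (chord_set R) = R"
  by (intro ext) (auto simp: chord_set_def chord_rel_def chord_eq_iff)

lemma chords_cross_iff:
  assumes "i < j" "j < n" "k < l" "l < n"
  shows "(chord i j \<noteq> chord k l \<longrightarrow> rel_interior (chord i j) \<inter> rel_interior (chord k l) = {})
    \<longleftrightarrow> \<not> crosses i j k l"
proof (cases "(i, j) = (k, l)")
  case True then show ?thesis by (auto simp: crosses_def)
next
  case False
  then show ?thesis using open_segments_meet_iff[OF assms False] assms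
    by (simp add: rel_interior_chord chord_eq_iff) blast
qed

lemma triangulation_iff_chords:
  "T \<in> triangulations (polygon_vertices P) \<longleftrightarrow>
     T \<subseteq> segment_arcs (polygon_vertices P) \<and> chord_triangulation n (chord_rel T)"
proof (cases "T \<subseteq> segment_arcs (polygon_vertices P)")
  case True
  have T: "\<exists>i j. a = chord i j \<and> chord_rel T i j" if "a \<in> T" for a
    using subsetD[OF True that] that unfolding segment_arcs_vertices chord_rel_def by blast
  have lt: "chord_rel T i j \<Longrightarrow> i < j \<and> j < n" for i j by (simp add: chord_rel_def)
  have nc: "(\<forall>a\<in>T. \<forall>b\<in>T. a \<noteq> b \<longrightarrow> rel_interior a \<inter> rel_interior b = {}) \<longleftrightarrow>
      (\<forall>i j k l. chord_rel T i j \<longrightarrow> chord_rel T k l \<longrightarrow> \<not> crosses i j k l)" (is "?l \<longleftrightarrow> ?r")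
  proof
    assume l: ?l
    show ?r
    proof (intro allI impI)
      fix i j k l assume "chord_rel T i j" "chord_rel T k l"
      then show "\<not> crosses i j k l"
        using l chords_cross_iff[of i j k l] unfolding chord_rel_def by blast
    qed
  next
    assume r: ?r
    show ?l
    proof (intro ballI)
      fix a b assume "a \<in> T" "b \<in> T"
      then obtain i j k l where "a = chord i j" "chord_rel T i j" "b = chord k l" "chord_rel T k l"
        using T by meson
      then show "a \<noteq> b \<longrightarrow> rel_interior a \<inter> rel_interior b = {}"
        using r lt chords_cross_iff by metis
    qed
  qed
  have free: "(\<forall>b\<in>T. chord i j \<noteq> b \<longrightarrow> rel_interior (chord i j) \<inter> rel_interior b = {}) \<longleftrightarrow>
      (\<forall>k l. chord_rel T k l \<longrightarrow> \<not> crosses i j k l)" if ij: "i < j" "j < n" for i j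
  proof
    assume l: "\<forall>b\<in>T. chord i j \<noteq> b \<longrightarrow> rel_interior (chord i j) \<inter> rel_interior b = {}"
    show "\<forall>k l. chord_rel T k l \<longrightarrow> \<not> crosses i j k l"
    proof (intro allI impI)
      fix k l assume "chord_rel T k l"
      then show "\<not> crosses i j k l"
        using l chords_cross_iff[OF ij, of k l] unfolding chord_rel_def by blast
    qed
  next
    assume r: "\<forall>k l. chord_rel T k l \<longrightarrow> \<not> crosses i j k l"
    show "\<forall>b\<in>T. chord i j \<noteq> b \<longrightarrow> rel_interior (chord i j) \<inter> rel_interior b = {}"
    proof
      fix b assume "b \<in> T"
      then obtain k l where "b = chord k l" "chord_rel T k l" using T by meson
      then show "chord i j \<noteq> b \<longrightarrow> rel_interior (chord i j) \<inter> rel_interior b = {}"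
        using r lt chords_cross_iff[OF ij] by metis
    qed
  qed
  have mx: "(\<forall>a\<in>segment_arcs (polygon_vertices P).
        (\<forall>b\<in>T. a \<noteq> b \<longrightarrow> rel_interior a \<inter> rel_interior b = {}) \<longrightarrow> a \<in> T) \<longleftrightarrow>
      (\<forall>i j. i < j \<longrightarrow> j < n \<longrightarrow> (\<forall>k l. chord_rel T k l \<longrightarrow> \<not> crosses i j k l) \<longrightarrow> chord_rel T i j)"
    (is "?l \<longleftrightarrow> ?r")
  proof
    assume l: ?l
    show ?r
    proof (intro allI impI)
      fix i j assume ij: "i < j" "j < n" and "\<forall>k l. chord_rel T k l \<longrightarrow> \<not> crosses i j k l"
      then have "\<forall>b\<in>T. chord i j \<noteq> b \<longrightarrow> rel_interior (chord i j) \<inter> rel_interior b = {}" using free by simp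
      moreover have "chord i j \<in> segment_arcs (polygon_vertices P)" using ij segment_arcs_vertices by blast
      ultimately have "chord i j \<in> T" using l by simp
      then show "chord_rel T i j" using ij by (simp add: chord_rel_def)
    qed
  next
    assume r: ?r
    show ?l
    proof (intro ballI impI)
      fix a assume "a \<in> segment_arcs (polygon_vertices P)"
        and a: "\<forall>b\<in>T. a \<noteq> b \<longrightarrow> rel_interior a \<inter> rel_interior b = {}"
      then obtain i j where ij: "a = chord i j" "i < j" "j < n" using segment_arcs_vertices by blast
      then have "\<forall>k l. chord_rel T k l \<longrightarrow> \<not> crosses i j k l" using a free[OF ij(2,3)] by simp
      then have "chord_rel T i j" using r ij(2,3) by simp
      then show "a \<in> T" using ij by (simp add: chord_rel_def)
    qed
  qed
  show ?thesis unfolding triangulations_iff chord_triangulation_def using True nc mx lt by simp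
next
  case False
  then show ?thesis by (auto simp: triangulations_iff)
qed

lemma chord_set_triangulation:
  assumes "chord_triangulation n R"
  shows "chord_set R \<in> triangulations (polygon_vertices P)"
proof -
  have "chord_rel (chord_set R) = R"
    using assms by (intro chord_rel_chord_set) (simp add: chord_triangulation_def)
  then show ?thesis using assms triangulation_iff_chords
    by (auto simp: segment_arcs_vertices chord_set_def)
qed

lemma equal_or_flip_chord_sets:
  assumes "chord_triangulation n R" "chord_triangulation n S"
    and "\<And>i j k l. R i j \<Longrightarrow> \<not> S i j \<Longrightarrow> R k l \<Longrightarrow> \<not> S k l \<Longrightarrow> (i, j) = (k, l)"
    and "\<And>i j k l. S i j \<Longrightarrow> \<not> R i j \<Longrightarrow> S k l \<Longrightarrow> \<not> R k l \<Longrightarrow> (i, j) = (k, l)"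
  shows "chord_set R = chord_set S \<or> (chord_set R, chord_set S) \<in> parcs (flip_graph (polygon_vertices P))"
proof (rule equal_or_flip)
  show "x = y" if "x \<in> chord_set R - chord_set S" "y \<in> chord_set R - chord_set S" for x y
    using that assms(3) unfolding chord_set_def by blast
  show "x = y" if "x \<in> chord_set S - chord_set R" "y \<in> chord_set S - chord_set R" for x y
    using that assms(4) unfolding chord_set_def by blast
qed (rule assms(1,2)[THEN chord_set_triangulation])+

end

section \<open>Arcs of the punctured polygon as chords and spokes\<close>

context punctured_labelling
begin

definition spoke :: "nat \<Rightarrow> (real^2) set" where
  "spoke s = closed_segment p (\<nu> s)"

definition spoke_rel :: "(real^2) set set \<Rightarrow> nat \<Rightarrow> bool" where
  "spoke_rel T s \<longleftrightarrow> s < n \<and> spoke s \<in> T"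

lemma spoke_eq_iff: "s < n \<Longrightarrow> t < n \<Longrightarrow> spoke s = spoke t \<longleftrightarrow> s = t"
  using vertex_eq_iff p_not_vertex[of s] p_not_vertex[of t] by (auto simp: spoke_def doubleton_eq_iff)

lemma spoke_neq_chord: "i < n \<Longrightarrow> j < n \<Longrightarrow> spoke s \<noteq> chord i j"
  using p_not_vertex[of i] p_not_vertex[of j] by (auto simp: spoke_def chord_def doubleton_eq_iff)

lemma rel_interior_spoke: "s < n \<Longrightarrow> rel_interior (spoke s) = open_segment p (\<nu> s)"
  using p_not_vertex by (simp add: spoke_def rel_interior_closed_segment)

lemma segment_arcs_punctured:
  "segment_arcs (insert p (polygon_vertices P)) =
     {chord i j | i j. i < j \<and> j < n \<and> \<sigma> i j \<noteq> 0} \<union> spoke ` {..<n}"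
proof (intro set_eqI iffI)
  fix e assume "e \<in> segment_arcs (insert p (polygon_vertices P))"
  then obtain a b where ab: "e = closed_segment a b" "a \<in> insert p (polygon_vertices P)"
    "b \<in> insert p (polygon_vertices P)" "a \<noteq> b" "open_segment a b \<inter> insert p (polygon_vertices P) = {}"
    by (auto simp: segment_arcs_def)
  show "e \<in> {chord i j | i j. i < j \<and> j < n \<and> \<sigma> i j \<noteq> 0} \<union> spoke ` {..<n}"
  proof (cases "a = p \<or> b = p")
    case True
    then obtain v where v: "v \<in> polygon_vertices P" "e = closed_segment p v"
      using ab(1-4) by (metis closed_segment_commute insertE)
    then have "e \<in> spoke ` {..<n}" unfolding polygon_vertices_P spoke_def by blast
    then show ?thesis by blast
  next
    case False
    then have "a \<in> polygon_vertices P" "b \<in> polygon_vertices P" "open_segment a b \<inter> polygon_vertices P = {}"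
      using ab by auto
    then have "e \<in> segment_arcs (polygon_vertices P)" using ab unfolding segment_arcs_def by blast
    then obtain i j where ij: "e = chord i j" "i < j" "j < n" by (auto simp: segment_arcs_vertices)
    have "open_segment a b = open_segment (\<nu> i) (\<nu> j)"
      using ij ab rel_interior_chord[OF ij(2,3)] rel_interior_closed_segment[of a b] by simp
    then have "p \<notin> open_segment (\<nu> i) (\<nu> j)" using ab(5) by blast
    then have "\<sigma> i j \<noteq> 0" using puncture_on_chord_iff[OF ij(2,3)] by simp
    then show ?thesis using ij by blast
  qed
next
  fix e assume "e \<in> {chord i j | i j. i < j \<and> j < n \<and> \<sigma> i j \<noteq> 0} \<union> spoke ` {..<n}"
  then consider i j where "e = chord i j" "i < j" "j < n" "\<sigma> i j \<noteq> 0" | s where "e = spoke s" "s < n" by blast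
  then show "e \<in> segment_arcs (insert p (polygon_vertices P))"
  proof cases
    case 1
    then have "open_segment (\<nu> i) (\<nu> j) \<inter> insert p (polygon_vertices P) = {}"
      using vertex_not_in_open_segment[of "\<nu> i" "\<nu> j"] vertex_in[of i] vertex_in[of j] puncture_on_chord_iff[of i j]
      by auto
    moreover have "\<nu> i \<in> polygon_vertices P" "\<nu> j \<in> polygon_vertices P" using 1 by (auto simp: polygon_vertices_P)
    ultimately show ?thesis using 1 vertex_less_neq[of i j] unfolding segment_arcs_def chord_def by blast
  next
    case 2
    then have "open_segment p (\<nu> s) \<inter> insert p (polygon_vertices P) = {}"
      using vertex_not_in_open_segment[of p "\<nu> s"] p_in vertex_in[of s] by (auto simp: open_segment_def)
    moreover have "\<nu> s \<in> polygon_vertices P" using 2 by (auto simp: polygon_vertices_P)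
    ultimately show ?thesis using 2 p_not_vertex[of s] unfolding segment_arcs_def spoke_def by blast
  qed
qed

lemma spoke_crosses_iff:
  assumes "i < j" "j < n" "s < n" "\<sigma> i j \<noteq> 0"
  shows "rel_interior (chord i j) \<inter> rel_interior (spoke s) = {} \<longleftrightarrow> \<not> spoke_crosses \<sigma> s i j"
  using spoke_meets_iff[OF assms] assms by (simp add: rel_interior_chord rel_interior_spoke) blast

lemma triangulation_imp_spoked:
  assumes T: "T \<in> triangulations (insert p (polygon_vertices P))"
  shows "spoked_triangulation n \<sigma> (chord_rel T) (spoke_rel T)"
proof -
  note T' = T[unfolded triangulations_iff]
  have sub: "T \<subseteq> {chord i j | i j. i < j \<and> j < n \<and> \<sigma> i j \<noteq> 0} \<union> spoke ` {..<n}"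
    using T' segment_arcs_punctured by simp
  have nc: "rel_interior a \<inter> rel_interior b = {}" if "a \<in> T" "b \<in> T" "a \<noteq> b" for a b
    using T' that by simp
  have mx: "a \<in> T" if "a \<in> segment_arcs (insert p (polygon_vertices P))"
      "\<And>b. b \<in> T \<Longrightarrow> a \<noteq> b \<Longrightarrow> rel_interior a \<inter> rel_interior b = {}" for a
    using T' that by simp
  have nz: "\<sigma> i j \<noteq> 0" if "chord_rel T i j" for i j
  proof -
    have ij: "i < j" "j < n" "chord i j \<in> T" using that by (auto simp: chord_rel_def)
    then have "chord i j \<notin> spoke ` {..<n}" using spoke_neq_chord[of i j] by auto
    then show ?thesis using sub ij by (auto simp: chord_eq_iff)
  qed
  have T_cases: thesis
    if "b \<in> T" "\<And>k l. b = chord k l \<Longrightarrow> chord_rel T k l \<Longrightarrow> thesis"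
      "\<And>s. b = spoke s \<Longrightarrow> spoke_rel T s \<Longrightarrow> thesis" for b thesis
    using that sub unfolding chord_rel_def spoke_rel_def by blast
  show ?thesis
    unfolding spoked_triangulation_def
  proof (intro conjI allI impI)
    show "i < j" "j < n" "\<sigma> i j \<noteq> 0" if "chord_rel T i j" for i j
      using that nz by (auto simp: chord_rel_def)
    show "s < n" if "spoke_rel T s" for s using that by (simp add: spoke_rel_def)
    show "\<not> crosses i j k l" if "chord_rel T i j" "chord_rel T k l" for i j k l
      using that chords_cross_iff[of i j k l] nc[of "chord i j" "chord k l"] by (auto simp: chord_rel_def)
    show "\<not> spoke_crosses \<sigma> s i j" if "chord_rel T i j" "spoke_rel T s" for i j s
      using that spoke_crosses_iff[of i j s] nz nc[of "chord i j" "spoke s"] spoke_neq_chord[of i j s]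
      by (auto simp: chord_rel_def spoke_rel_def)
    show "chord_rel T i j" if ij: "i < j" "j < n" "\<sigma> i j \<noteq> 0"
      and free: "\<forall>k l. chord_rel T k l \<longrightarrow> \<not> crosses i j k l" "\<forall>s. spoke_rel T s \<longrightarrow> \<not> spoke_crosses \<sigma> s i j" for i j
    proof -
      have "chord i j \<in> T"
      proof (rule mx)
        show "chord i j \<in> segment_arcs (insert p (polygon_vertices P))"
          using ij by (auto simp: segment_arcs_punctured)
        fix b assume "b \<in> T" "chord i j \<noteq> b"
        then show "rel_interior (chord i j) \<inter> rel_interior b = {}"
        proof (elim T_cases)
          fix k l assume "b = chord k l" "chord_rel T k l"
          then show ?thesis using free chords_cross_iff[of i j k l] ij \<open>chord i j \<noteq> b\<close> by (auto simp: chord_rel_def)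
        next
          fix s assume "b = spoke s" "spoke_rel T s"
          then show ?thesis using free spoke_crosses_iff[of i j s] ij by (auto simp: spoke_rel_def)
        qed
      qed
      then show ?thesis using ij by (simp add: chord_rel_def)
    qed
    show "spoke_rel T s" if s: "s < n" and free: "\<forall>i j. chord_rel T i j \<longrightarrow> \<not> spoke_crosses \<sigma> s i j" for s
    proof -
      have "spoke s \<in> T"
      proof (rule mx)
        show "spoke s \<in> segment_arcs (insert p (polygon_vertices P))"
          using s by (auto simp: segment_arcs_punctured)
        fix b assume "b \<in> T" "spoke s \<noteq> b"
        then show "rel_interior (spoke s) \<inter> rel_interior b = {}"
        proof (elim T_cases)
          fix k l assume "b = chord k l" "chord_rel T k l"
          then show ?thesis using free spoke_crosses_iff[of k l s] s nz by (auto simp: chord_rel_def)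
        next
          fix t assume "b = spoke t" "spoke_rel T t"
          then show ?thesis using spokes_disjoint[of s t] s \<open>spoke s \<noteq> b\<close>
            by (auto simp: spoke_rel_def rel_interior_spoke)
        qed
      qed
      then show ?thesis using s by (simp add: spoke_rel_def)
    qed
  qed
qed

end

section \<open>Contracting the puncture\<close>

locale central_labelling = punctured_labelling n \<nu> P p + central_puncture n "\<lambda>i j. orient (\<nu> i) (\<nu> j) p"
  for n \<nu> P p
begin

definition contract_puncture :: "(real^2) set set \<Rightarrow> (real^2) set set" where
  "contract_puncture T = chord_set (contract_spokes n \<sigma> (chord_rel T) (spoke_rel T))"

definition contract_vertex :: "(real^2) set set \<Rightarrow> (real^2) set set" where
  "contract_vertex T = chord_set (contract_chords n (chord_rel T))"

lemma chord_triangulation_contract_puncture: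
  "T \<in> triangulations (insert p (polygon_vertices P)) \<Longrightarrow>
     chord_triangulation n (contract_spokes n \<sigma> (chord_rel T) (spoke_rel T))"
  using chord_triangulation_contract_spokes triangulation_imp_spoked by blast

text \<open>Each arc is the source of at most one contracted chord. A contracted chord that
  disappears must have a source among the arcs lost in the flip, and there is only one of these.
  Whether the ear chord is dropped depends on its sign alone.\<close>

lemma contract_puncture_flip:
  assumes TU: "(T, U) \<in> parcs (flip_graph (insert p (polygon_vertices P)))"
  shows "contract_puncture T = contract_puncture U \<or>
    (contract_puncture T, contract_puncture U) \<in> parcs (flip_graph (polygon_vertices P))"
proof -
  have T: "T \<in> triangulations (insert p (polygon_vertices P))"
    and U: "U \<in> triangulations (insert p (polygon_vertices P))"
    and c: "card (T - U) = 1" "card (U - T) = 1"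
    using TU by (auto simp: flip_graph_def)
  have unique: "(i, j) = (k, l)"
    if c: "card (T - U) = 1"
      and ij: "contract_spokes n \<sigma> (chord_rel T) (spoke_rel T) i j"
        "\<not> contract_spokes n \<sigma> (chord_rel U) (spoke_rel U) i j"
      and kl: "contract_spokes n \<sigma> (chord_rel T) (spoke_rel T) k l"
        "\<not> contract_spokes n \<sigma> (chord_rel U) (spoke_rel U) k l"
    for T U :: "(real^2) set set" and i j k l
  proof -
    obtain e where e: "T - U = {e}" using c card_1_singletonE by blast
    have *: "a < b \<and> b < n \<and> (e = chord a b \<or> a = 0 \<and> e = spoke b)"
      if "contract_spokes n \<sigma> (chord_rel T) (spoke_rel T) a b"
        "\<not> contract_spokes n \<sigma> (chord_rel U) (spoke_rel U) a b" for a b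
    proof -
      have "a < b \<and> b < n \<and> (chord a b \<in> T - U \<or> a = 0 \<and> spoke b \<in> T - U)"
      proof (cases "a = 0")
        case True
        then have "0 < b" "chord_rel T 0 b \<or> spoke_rel T b" "\<not> chord_rel U 0 b" "\<not> spoke_rel U b"
          using that unfolding contract_spokes_def by simp_all
        then show ?thesis using True unfolding chord_rel_def spoke_rel_def by blast
      next
        case False
        then have "chord_rel T a b" "\<not> chord_rel U a b"
          using that unfolding contract_spokes_def by (simp_all only: if_False) blast+
        then show ?thesis unfolding chord_rel_def by blast
      qed
      then show ?thesis unfolding e by blast
    qed
    have lt: "i < j" "j < n" "k < l" "l < n" "i < n" "k < n" using *[OF ij] *[OF kl] by linarith+
    consider "e = chord i j" "e = chord k l" | "e = chord i j" "e = spoke l"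
      | "e = spoke j" "e = chord k l" | "i = 0" "k = 0" "e = spoke j" "e = spoke l"
      using *[OF ij] *[OF kl] by blast
    then show ?thesis
    proof cases
      case 1
      then show ?thesis using chord_eq_iff[OF lt(1-4)] by simp
    next
      case 2
      then show ?thesis using spoke_neq_chord[OF lt(5,2), of l] by simp
    next
      case 3
      then show ?thesis using spoke_neq_chord[OF lt(6,4), of j] by simp
    next
      case 4
      then show ?thesis using spoke_eq_iff[OF lt(2,4)] by simp
    qed
  qed
  show ?thesis
    unfolding contract_puncture_def
    by (rule equal_or_flip_chord_sets[OF T[THEN chord_triangulation_contract_puncture]
        U[THEN chord_triangulation_contract_puncture] unique[OF c(1)] unique[OF c(2)]])
qed

text \<open>The same count of sources: (1, b) arises from itself or from (0, b), and the boundary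
  edges at 0 are always present.\<close>

lemma contract_vertex_flip:
  assumes TU: "(T, U) \<in> parcs (flip_graph (polygon_vertices P))"
  shows "contract_vertex T = contract_vertex U \<or>
    (contract_vertex T, contract_vertex U) \<in> parcs (flip_graph (polygon_vertices P))"
proof -
  have "T \<in> triangulations (polygon_vertices P)" "U \<in> triangulations (polygon_vertices P)"
    and c: "card (T - U) = 1" "card (U - T) = 1"
    using TU by (auto simp: flip_graph_def)
  then have T: "chord_triangulation n (contract_chords n (chord_rel T))"
    and U: "chord_triangulation n (contract_chords n (chord_rel U))"
    using chord_triangulation_contract_chords[OF n3] triangulation_iff_chords by auto
  have unique: "(i, j) = (k, l)"
    if c: "card (T - U) = 1"
      and ij: "contract_chords n (chord_rel T) i j" "\<not> contract_chords n (chord_rel U) i j"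
      and kl: "contract_chords n (chord_rel T) k l" "\<not> contract_chords n (chord_rel U) k l"
    for T U :: "(real^2) set set" and i j k l
  proof -
    obtain e where e: "T - U = {e}" using c card_1_singletonE by blast
    have *: "0 < a \<and> a < b \<and> b < n \<and> (e = chord a b \<or> a = 1 \<and> e = chord 0 b)"
      if "contract_chords n (chord_rel T) a b" "\<not> contract_chords n (chord_rel U) a b" for a b
    proof -
      have "0 < a \<and> a < b \<and> b < n \<and> (chord a b \<in> T - U \<or> a = 1 \<and> chord 0 b \<in> T - U)"
        using that by (auto simp: contract_chords_def chord_rel_def)
      then show ?thesis unfolding e by auto
    qed
    have lt: "0 < i" "i < j" "j < n" "0 < k" "k < l" "l < n" "0 < j" "0 < l"
      using *[OF ij] *[OF kl] by linarith+
    consider "e = chord i j" "e = chord k l" | "e = chord i j" "e = chord 0 l"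
      | "e = chord 0 j" "e = chord k l" | "i = 1" "k = 1" "e = chord 0 j" "e = chord 0 l"
      using *[OF ij] *[OF kl] by blast
    then show ?thesis
    proof cases
      case 1
      then show ?thesis using chord_eq_iff[OF lt(2,3,5,6)] by simp
    next
      case 2
      then show ?thesis using chord_eq_iff[OF lt(2,3,8,6)] lt by simp
    next
      case 3
      then show ?thesis using chord_eq_iff[OF lt(7,3,5,6)] lt by simp
    next
      case 4
      then show ?thesis using chord_eq_iff[OF lt(7,3,8,6)] by simp
    qed
  qed
  show ?thesis
    unfolding contract_vertex_def
    by (rule equal_or_flip_chord_sets[OF T U unique[OF c(1)] unique[OF c(2)]])
qed

lemma contract_vertex_fixes:
  assumes T: "T \<in> triangulations (polygon_vertices P)" and ear: "chord 1 (n - 1) \<in> T"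
  shows "contract_vertex T = T"
proof -
  have "chord_rel T 1 (n - 1)" using ear n4 by (simp add: chord_rel_def)
  then show ?thesis
    using T contract_chords_ear[OF n3] chord_set_chord_rel by (simp add: contract_vertex_def triangulation_iff_chords)
qed

section \<open>Puncture flips in terms of labels\<close>

lemma segment_in_triangulation:
  assumes "T \<in> triangulations (polygon_vertices P)" "closed_segment a b \<in> T"
  obtains i j where "a = \<nu> i" "b = \<nu> j" "i < n" "j < n" "chord_rel T i j \<or> chord_rel T j i"
proof -
  have "closed_segment a b \<in> segment_arcs (polygon_vertices P)" using assms triangulation_iff_chords by auto
  then obtain k l where kl: "closed_segment a b = chord k l" "k < l" "l < n"
    unfolding segment_arcs_vertices by blast
  then have "chord_rel T k l" using assms by (simp add: chord_rel_def)
  moreover have "a = \<nu> k \<and> b = \<nu> l \<or> a = \<nu> l \<and> b = \<nu> k"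
    using kl(1) by (auto simp: chord_def doubleton_eq_iff)
  ultimately show ?thesis using that[of k l] that[of l k] kl by auto
qed

lemma sort_three:
  fixes x y z :: nat
  assumes "x \<noteq> y" "y \<noteq> z" "z \<noteq> x"
  obtains i j k where "i < j" "j < k" "{x, y, z} = {i, j, k}"
proof -
  consider "x < y" "y < z" | "x < z" "z < y" | "y < x" "x < z" | "y < z" "z < x" | "z < x" "x < y" | "z < y" "y < x"
    using assms by linarith
  then show ?thesis
    by cases (use that in \<open>metis insert_commute\<close>)+
qed

lemma triangle_labels:
  assumes T: "T \<in> triangulations (polygon_vertices P)" and abc: "is_triangle_of T a b c"
  obtains x y z where "a = \<nu> x" "b = \<nu> y" "c = \<nu> z" "x < n" "y < n" "z < n"
    "chord_rel T x y \<or> chord_rel T y x" "chord_rel T y z \<or> chord_rel T z y" "chord_rel T z x \<or> chord_rel T x z"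
proof -
  have s: "closed_segment a b \<in> T" "closed_segment b c \<in> T" "closed_segment c a \<in> T"
    using abc by (auto simp: is_triangle_of_def)
  obtain x y where xy: "a = \<nu> x" "b = \<nu> y" "x < n" "y < n" "chord_rel T x y \<or> chord_rel T y x"
    using segment_in_triangulation[OF T s(1)] by blast
  obtain y' z where yz: "b = \<nu> y'" "c = \<nu> z" "y' < n" "z < n" "chord_rel T y' z \<or> chord_rel T z y'"
    using segment_in_triangulation[OF T s(2)] by blast
  obtain z' x' where zx: "c = \<nu> z'" "a = \<nu> x'" "z' < n" "x' < n" "chord_rel T z' x' \<or> chord_rel T x' z'"
    using segment_in_triangulation[OF T s(3)] by blast
  have "y' = y" "z' = z" "x' = x" using xy yz zx vertex_eq_iff by metis+
  then show ?thesis using that xy yz zx by blast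
qed

text \<open>Once the labels of the triangle are sorted, the side from \<open>i\<close> to
  \<open>k\<close> is the one with the third vertex between its ends, which determines the sign
  there. In the second case \<open>z\<close> and \<open>w\<close> are the vertices opposite the
  removed edge.\<close>

lemma puncture_flip_cases:
  assumes T: "T \<in> triangulations (polygon_vertices P)" and flip: "puncture_flip p T T'"
  obtains (triangle) i j k where "i < j" "j < k" "k < n"
      "chord_rel T i j" "chord_rel T j k" "chord_rel T i k" "\<sigma> i k < 0"
      "chord_rel T' = chord_rel T" "\<And>s. spoke_rel T' s \<Longrightarrow> s = i \<or> s = j \<or> s = k"
  | (edge) x y z w where "chord_rel T x y" "\<sigma> x y = 0" "z \<noteq> w"
      "chord_rel T x z \<or> chord_rel T z x" "chord_rel T y z \<or> chord_rel T z y"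
      "chord_rel T x w \<or> chord_rel T w x" "chord_rel T y w \<or> chord_rel T w y"
      "\<And>i j. chord_rel T' i j \<longleftrightarrow> chord_rel T i j \<and> (i, j) \<noteq> (x, y)"
      "\<And>s. spoke_rel T' s \<Longrightarrow> s = x \<or> s = y \<or> s = z \<or> s = w"
proof -
  have sub: "T \<subseteq> {chord i j | i j. i < j \<and> j < n}" using T triangulation_iff_chords segment_arcs_vertices by simp
  have lt: "chord_rel T i j \<Longrightarrow> i < j \<and> j < n" for i j by (simp add: chord_rel_def)
  have no_spoke: "spoke s \<notin> T" for s
  proof
    assume "spoke s \<in> T"
    then obtain i j where "spoke s = chord i j" "i < j" "j < n" using sub by blast
    then show False using spoke_neq_chord[of i j s] by simp
  qed
  have chord_spoke: "chord i j \<notin> spoke ` S" if "i < j" "j < n" for i j S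
    using spoke_neq_chord[of i j] that by auto
  have spokes: "closed_segment p ` \<nu> ` S = spoke ` S" for S by (simp add: spoke_def image_image)
  consider a b c where "is_triangle_of T a b c" "p \<in> interior (convex hull {a, b, c})"
      "T' = T \<union> closed_segment p ` {a, b, c}"
    | a b c d where "is_triangle_of T a b c" "is_triangle_of T a b d" "c \<noteq> d" "p \<in> closed_segment a b"
        "T' = (T - {closed_segment a b}) \<union> closed_segment p ` {a, b, c, d}"
    using flip unfolding puncture_flip_def by blast
  then show ?thesis
  proof cases
    case 1
    obtain x y z where l: "a = \<nu> x" "b = \<nu> y" "c = \<nu> z" "x < n" "y < n" "z < n"
      and adj: "chord_rel T x y \<or> chord_rel T y x" "chord_rel T y z \<or> chord_rel T z y" "chord_rel T z x \<or> chord_rel T x z"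
      using triangle_labels[OF T 1(1)] by blast
    have "x \<noteq> y" "y \<noteq> z" "z \<noteq> x" using adj lt by blast+
    then obtain i j k where ijk: "i < j" "j < k" and set: "{x, y, z} = {i, j, k}" by (rule sort_three)
    have E: "chord_rel T u v" if "u \<in> {x, y, z}" "v \<in> {x, y, z}" "u < v" for u v
      using that adj lt[of v u] by auto
    have "k < n" using l set by (metis insertCI insertE singletonD)
    have abc: "{a, b, c} = \<nu> ` {i, j, k}" unfolding set[symmetric] l by simp
    have "\<sigma> k i > 0"
    proof (rule orient_interior_pos)
      show "p \<in> interior (convex hull (\<nu> ` {i, j, k}))" using 1(2) abc by simp
      show "\<nu> k \<noteq> \<nu> i" using vertex_eq_iff ijk \<open>k < n\<close> by auto
      fix q assume "q \<in> convex hull (\<nu> ` {i, j, k})"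
      then show "orient (\<nu> k) (\<nu> i) q \<ge> 0"
      proof (rule orient_hull_nonneg[rotated])
        fix u assume "u \<in> \<nu> ` {i, j, k}"
        moreover have "orient (\<nu> k) (\<nu> i) (\<nu> j) > 0" using ccw[of i j k] ijk \<open>k < n\<close> orient_rotate by metis
        ultimately show "orient (\<nu> k) (\<nu> i) u \<ge> 0" by auto
      qed
    qed
    then have "\<sigma> i k < 0" using orient_swap[of "\<nu> i" "\<nu> k" p] by simp
    have T': "T' = T \<union> spoke ` {i, j, k}" using 1(3) unfolding abc spokes .
    show ?thesis
    proof (rule triangle[OF ijk \<open>k < n\<close>])
      show "chord_rel T i j" "chord_rel T j k" "chord_rel T i k"
        using E ijk unfolding set by auto
      show "chord_rel T' = chord_rel T"
      proof (intro ext)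
        fix u v
        show "chord_rel T' u v = chord_rel T u v"
          using chord_spoke[of u v "{i, j, k}"] unfolding chord_rel_def T' by blast
      qed
      fix s assume s: "spoke_rel T' s"
      then have "spoke s \<in> spoke ` {i, j, k}" "s < n" using no_spoke by (auto simp: spoke_rel_def T')
      then show "s = i \<or> s = j \<or> s = k" using spoke_eq_iff ijk \<open>k < n\<close> by auto
    qed fact
  next
    case 2
    obtain x y z where l: "a = \<nu> x" "b = \<nu> y" "c = \<nu> z" "x < n" "y < n" "z < n"
      and adj: "chord_rel T x y \<or> chord_rel T y x" "chord_rel T y z \<or> chord_rel T z y" "chord_rel T z x \<or> chord_rel T x z"
      using triangle_labels[OF T 2(1)] by blast
    obtain x' y' w where l': "a = \<nu> x'" "b = \<nu> y'" "d = \<nu> w" "x' < n" "y' < n" "w < n"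
      and adj': "chord_rel T y' w \<or> chord_rel T w y'" "chord_rel T w x' \<or> chord_rel T x' w"
      using triangle_labels[OF T 2(2)] by blast
    have e: "x' = x" "y' = y" using l l' vertex_eq_iff by metis+
    have "z \<noteq> w" using 2(3) l l' by auto
    \<comment> \<open>Stated for either order of the two labels, since the removed edge comes
      without an orientation.\<close>
    have edge': thesis
      if xy: "chord_rel T x y" and seg: "closed_segment a b = chord x y" "{a, b, c, d} = \<nu> ` {x, y, z, w}"
        and lt4: "x < n" "y < n"
        and tri: "chord_rel T x z \<or> chord_rel T z x" "chord_rel T y z \<or> chord_rel T z y"
          "chord_rel T x w \<or> chord_rel T w x" "chord_rel T y w \<or> chord_rel T w y" for x y
    proof (rule edge[OF xy _ \<open>z \<noteq> w\<close> tri])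
      have xy': "x < y" "y < n" using lt[OF xy] by auto
      have "p \<in> open_segment (\<nu> x) (\<nu> y)"
        using 2(4) p_not_vertex[of x] p_not_vertex[of y] lt4 unfolding seg chord_def open_segment_def by auto
      then show "\<sigma> x y = 0" using puncture_on_chord_iff[OF xy'] by simp
      have T': "T' = (T - {chord x y}) \<union> spoke ` {x, y, z, w}" using 2(5) unfolding seg spokes .
      show "chord_rel T' i j \<longleftrightarrow> chord_rel T i j \<and> (i, j) \<noteq> (x, y)" for i j
      proof (cases "i < j \<and> j < n")
        case True
        then have "chord i j \<in> T' \<longleftrightarrow> chord i j \<in> T \<and> chord i j \<noteq> chord x y"
          using chord_spoke[of i j "{x, y, z, w}"] unfolding T' by blast
        then show ?thesis using True chord_eq_iff[of i j x y] xy' by (simp add: chord_rel_def)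
      qed (auto simp: chord_rel_def)
      fix s assume s: "spoke_rel T' s"
      then have "spoke s \<in> spoke ` {x, y, z, w}" "s < n" using no_spoke by (auto simp: spoke_rel_def T')
      then show "s = x \<or> s = y \<or> s = z \<or> s = w" using spoke_eq_iff lt4 l l' by auto
    qed
    show ?thesis
    proof (cases "chord_rel T x y")
      case True
      show ?thesis
        by (rule edge'[OF True]) (use l l' adj adj' e in \<open>auto simp: chord_def\<close>)
    next
      case False
      then have "chord_rel T y x" using adj by blast
      then show ?thesis
        by (rule edge') (use l l' adj adj' e in \<open>auto simp: chord_def closed_segment_commute\<close>)
    qed
  qed
qed

lemma contract_puncture_insertion:
  assumes T: "T \<in> triangulations (polygon_vertices P)"
    and T': "T' \<in> triangulations (insert p (polygon_vertices P))" and flip: "puncture_flip p T T'"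
  shows "contract_puncture T' = T \<or> chord 1 (n - 1) \<in> T \<and> contract_vertex (contract_puncture T') = T \<and>
    (T, contract_puncture T') \<in> parcs (flip_graph (polygon_vertices P))"
proof -
  let ?E = "chord_rel T" and ?E' = "chord_rel T'" and ?Q = "spoke_rel T'"
  let ?R = "contract_spokes n \<sigma> ?E' ?Q"
  have E: "chord_triangulation n ?E" and ET: "chord_set ?E = T"
    using T triangulation_iff_chords chord_set_chord_rel by auto
  have R: "chord_triangulation n ?R" using T' by (rule chord_triangulation_contract_puncture)
  \<comment> \<open>Here \<open>m\<close> is the vertex opposite the ear chord in the triangle away
    from 0. For both kinds of insertion the contraction differs from \<open>T\<close> at most by the
    flip of (1, n - 1) to (0, m).\<close>
  have across: ?thesis
    if ear: "?E 1 (n - 1)" and m: "?E 1 m"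
      and E': "\<And>i j. ?E' i j \<Longrightarrow> ?E i j" "\<And>i j. ?E i j \<Longrightarrow> (i, j) \<noteq> (1, n - 1) \<Longrightarrow> ?E' i j"
      and Q: "\<And>j. ?Q j \<Longrightarrow> j = 0 \<or> j = 1 \<or> j = m \<or> j = n - 1" for m
  proof -
    note ins = insertion_across_ear[OF E ear R E' Q m]
    have RR: "chord_rel (chord_set ?R) = ?R"
      using R by (intro chord_rel_chord_set) (simp add: chord_triangulation_def)
    have "contract_vertex (contract_puncture T') = T"
      unfolding contract_vertex_def contract_puncture_def RR using ins(1) ET by simp
    moreover have "chord_set ?E = chord_set ?R \<or> (chord_set ?E, chord_set ?R) \<in> parcs (flip_graph (polygon_vertices P))"
    proof (rule equal_or_flip_chord_sets[OF E R])
      show "(i, j) = (k, l)" if "?E i j" "\<not> ?R i j" "?E k l" "\<not> ?R k l" for i j k l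
        using ins(2)[of i j] ins(2)[of k l] that by simp
      show "(i, j) = (k, l)" if "?R i j" "\<not> ?E i j" "?R k l" "\<not> ?E k l" for i j k l
        using ins(3)[of i j] ins(3)[of k l] that by simp
    qed
    moreover have "chord 1 (n - 1) \<in> T" using ear by (simp add: chord_rel_def)
    ultimately show ?thesis unfolding ET contract_puncture_def by auto
  qed
  have same: ?thesis if "?R = ?E" using that ET by (simp add: contract_puncture_def)
  from T flip show ?thesis
  proof (cases rule: puncture_flip_cases)
    case (triangle i j k)
    have "?R = ?E \<or> ?E 1 (n - 1) \<and> ?E 1 j \<and> i = 1 \<and> k = n - 1"
      using insertion_into_triangle[OF E, of ?Q i j k] R triangle by simp
    then show ?thesis
    proof
      assume "?E 1 (n - 1) \<and> ?E 1 j \<and> i = 1 \<and> k = n - 1"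
      then show ?thesis using triangle by (intro across[of j]) auto
    qed (rule same)
  next
    case (edge x y z w)
    have "?R = ?E \<or> ?E 1 (n - 1) \<and> x = 1 \<and> y = n - 1 \<and> (z = 0 \<and> ?E 1 w \<or> w = 0 \<and> ?E 1 z)"
      using insertion_into_edge[OF E R _ edge(9,1,2,3,4,5,6,7)] edge(8) by blast
    then consider "?R = ?E" | "?E 1 (n - 1)" "x = 1" "y = n - 1" "z = 0" "?E 1 w"
      | "?E 1 (n - 1)" "x = 1" "y = n - 1" "w = 0" "?E 1 z" by blast
    then show ?thesis
    proof cases
      case 1 then show ?thesis by (rule same)
    next
      case 2
      show ?thesis
        by (rule across[OF 2(1,5)]) (use edge(8,9) 2 in blast)+
    next
      case 3
      show ?thesis
        by (rule across[OF 3(1,5)]) (use edge(8,9) 3 in blast)+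
    qed
  qed
qed

lemma strongly_convex_extended_flip_graph:
  "strongly_convex_embedding Inl (flip_graph (polygon_vertices P)) (extended_flip_graph P p)"
proof -
  let ?F = "flip_graph (polygon_vertices P)" and ?F' = "flip_graph (insert p (polygon_vertices P))"
  let ?I = "{(T, T'). T \<in> pverts ?F \<and> T' \<in> pverts ?F' \<and> puncture_flip p T T'}"
  let ?G = "{T \<in> triangulations (polygon_vertices P). chord 1 (n - 1) \<in> T}"
  interpret flip_projections ?F ?F' ?I contract_puncture contract_vertex ?G
  proof
    show "contract_puncture T' \<in> pverts ?F" if "T' \<in> pverts ?F'" for T'
      using that chord_set_triangulation chord_triangulation_contract_puncture
      by (simp add: flip_graph_def contract_puncture_def)
    show "contract_vertex T \<in> pverts ?F" if "T \<in> pverts ?F" for T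
      using that chord_set_triangulation chord_triangulation_contract_chords[OF n3]
      by (simp add: flip_graph_def contract_vertex_def triangulation_iff_chords)
    show "contract_puncture T' = T \<or> T \<in> ?G \<and> contract_vertex (contract_puncture T') = T \<and>
        (T, contract_puncture T') \<in> parcs ?F" if "(T, T') \<in> ?I" for T T'
      using that contract_puncture_insertion[of T T'] by (simp add: flip_graph_def)
  qed (use contract_puncture_flip contract_vertex_flip contract_vertex_fixes in \<open>auto simp: flip_graph_def\<close>)
  have "extended_flip_graph P p = joined"
    unfolding extended_flip_graph_def joined_def Let_def
    by (auto simp: image_iff)
  then show ?thesis using strongly_convex_embedding by simp
qed

end

section \<open>Boundary quadrilaterals\<close>

text \<open>An edge is a compact convex collinear set, hence a segment; its ends are extreme in it,
  so also in the polygon of which it is a face.\<close>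

lemma polygon_edge_segment:
  assumes Q: "convex_polygon m Q" and e: "e edge_of Q"
  obtains a b where "a \<in> polygon_vertices Q" "b \<in> polygon_vertices Q" "a \<noteq> b" "e = closed_segment a b"
proof -
  have face: "e face_of Q" and dim: "aff_dim e = 1" using e by (auto simp: edge_of_def)
  have "polytope e" using Q face face_of_polytope_polytope by (auto simp: convex_polygon_def)
  moreover have "collinear e" using dim by (simp add: collinear_aff_dim)
  ultimately obtain a b where ab: "e = closed_segment a b"
    using compact_convex_collinear_segment[of e] polytope_imp_compact polytope_imp_convex dim
    by (metis aff_dim_empty neg_equal_zero one_neq_neg_one)
  have "a \<noteq> b" using dim ab by auto
  moreover have "a \<in> polygon_vertices Q" "b \<in> polygon_vertices Q"
    using extreme_point_of_face[OF face] unfolding ab polygon_vertices_def by (auto simp: extreme_point_of_segment)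
  ultimately show ?thesis using that ab by blast
qed

context polygon_labelling
begin

text \<open>A chord with vertices on both sides is crossed by the chord joining two of them. A face
  meeting the interior of a segment of the polygon contains its ends, which would then be collinear
  with the chord.\<close>

lemma chord_edge_of_imp_adjacent:
  assumes e: "chord i j edge_of P" and ij: "i < j" "j < n"
  shows "j = Suc i \<or> i = 0 \<and> j = n - 1"
proof (rule ccontr)
  assume "\<not> ?thesis"
  then have "\<exists>k l. i < k \<and> k < j \<and> l < n \<and> (l < i \<or> j < l)"
    using ij by (metis Suc_lessI Suc_pred less_Suc_eq neq0_conv lessI zero_less_Suc diff_Suc_1 gr_implies_not0)
  then obtain k l where kl: "i < k" "k < j" "l < n" "l < i \<or> j < l" by blast
  have "open_segment (\<nu> i) (\<nu> j) \<inter> open_segment (\<nu> k) (\<nu> l) \<noteq> {}"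
  proof (cases "l < i")
    case True
    then show ?thesis using open_segments_meet_iff[of i j l k] ij kl
      by (auto simp: crosses_def open_segment_commute)
  next
    case False
    then show ?thesis using open_segments_meet_iff[of i j k l] ij kl by (auto simp: crosses_def)
  qed
  then obtain z where z: "z \<in> chord i j" "z \<in> open_segment (\<nu> k) (\<nu> l)"
    by (auto simp: chord_def open_segment_def)
  have "\<nu> k \<in> chord i j"
    using e z kl ij vertex_in[of k] vertex_in[of l] unfolding edge_of_def face_of_def by auto
  then have "orient (\<nu> i) (\<nu> j) (\<nu> k) = 0"
    by (auto simp: chord_def in_segment orient_convex_combination)
  then show False using orient_neg[of i k j] kl ij by simp
qed

text \<open>A shared edge joins labels adjacent on \<open>P\<close>, so among the sorted labels only
  the four cyclically consecutive pairs can be shared. Three such adjacencies make the labels a run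
  of four.\<close>

lemma boundary_quadrilateral_labels:
  assumes n: "n \<ge> 5" and Q: "boundary_quadrilateral Q P"
  obtains r where "r < n" "polygon_vertices Q = (\<lambda>i. \<nu> ((i + r) mod n)) ` {..<4}"
proof -
  have Q4: "convex_polygon 4 Q" and sub: "polygon_vertices Q \<subseteq> \<nu> ` {..<n}"
    and c3: "card {e. e edge_of Q \<and> e edge_of P} \<ge> 3"
    using Q polygon_vertices_P by (auto simp: boundary_quadrilateral_def)
  obtain A where A: "A \<subseteq> {..<n}" "polygon_vertices Q = \<nu> ` A" using sub by (auto simp: subset_image_iff)
  have "inj_on \<nu> A" using inj_on_vertices A(1) by (rule inj_on_subset)
  then have "card A = 4" using Q4 A(2) by (simp add: convex_polygon_def card_image)
  have fin: "finite A" using A(1) finite_subset by blast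
  obtain a b c d where abcd: "A = {a, b, c, d}" "a < b" "b < c" "c < d"
  proof -
    let ?xs = "sorted_list_of_set A"
    have "\<exists>a b c d. xs = [a, b, c, d]" if "length xs = 4" for xs :: "nat list"
      using that by (auto simp: numeral_eq_Suc length_Suc_conv)
    then obtain a b c d where "?xs = [a, b, c, d]" using \<open>card A = 4\<close> by fastforce
    moreover have "sorted_wrt (<) ?xs" "set ?xs = A" using fin by auto
    ultimately show ?thesis using that[of a b c d] by auto
  qed
  have "d < n" using A abcd by auto
  \<comment> \<open>Each adjacency accounts for at most one shared edge, which turns the count of
    edges into a count of true conditions.\<close>
  let ?if = "\<lambda>(cond :: bool) e. if cond then {e} else {}"
  have shared: "{e. e edge_of Q \<and> e edge_of P} \<subseteq> ?if (b = Suc a) (chord a b) \<union> ?if (c = Suc b) (chord b c)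
      \<union> ?if (d = Suc c) (chord c d) \<union> ?if (a = 0 \<and> d = n - 1) (chord a d)" (is "_ \<subseteq> ?U")
  proof
    fix e assume "e \<in> {e. e edge_of Q \<and> e edge_of P}"
    then have e: "e edge_of Q" "e edge_of P" by auto
    obtain v w where vw: "v \<in> polygon_vertices Q" "w \<in> polygon_vertices Q" "v \<noteq> w" "e = closed_segment v w"
      using polygon_edge_segment[OF Q4 e(1)] by blast
    then obtain i j where "i \<in> A" "j \<in> A" "i \<noteq> j" "e = chord i j" using A(2) by (auto simp: chord_def)
    then obtain i j where ij: "i \<in> A" "j \<in> A" "i < j" "e = chord i j"
      by (metis chord_commute linorder_neqE_nat)
    have "j < n" using ij A by auto
    have adj: "j = Suc i \<or> i = 0 \<and> j = n - 1"
      using chord_edge_of_imp_adjacent[OF _ ij(3) \<open>j < n\<close>] e(2) ij(4) by simp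
    have ia: "i = a \<or> i = b \<or> i = c \<or> i = d" and ja: "j = a \<or> j = b \<or> j = c \<or> j = d"
      using ij abcd(1) by auto
    have "i = a \<and> j = b \<and> b = Suc a \<or> i = b \<and> j = c \<and> c = Suc b \<or> i = c \<and> j = d \<and> d = Suc c
        \<or> i = a \<and> j = d \<and> a = 0 \<and> d = n - 1"
    proof (cases "j = Suc i")
      case True
      consider "i = a" | "i = b" | "i = c" | "i = d" using ia by blast
      then show ?thesis
      proof cases
        case 1
        then have "j = b" using True ja abcd(2-4) by linarith
        then show ?thesis using 1 True by simp
      next
        case 2
        then have "j = c" using True ja abcd(2-4) by linarith
        then show ?thesis using 2 True by simp
      next
        case 3
        then have "j = d" using True ja abcd(2-4) by linarith
        then show ?thesis using 3 True by simp
      next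
        case 4
        then have False using ij(3) ja abcd(2-4) by linarith
        then show ?thesis ..
      qed
    next
      case False
      then have 0: "i = 0" "j = n - 1" using adj by auto
      have "i = a" using ia 0(1) abcd(2-4) by auto
      moreover have "Suc j = n" using 0(2) \<open>j < n\<close> by simp
      then have "j = d" using ja abcd(2-4) \<open>d < n\<close> by auto
      ultimately show ?thesis using 0 by simp
    qed
    then show "e \<in> ?U" using ij(4) by auto
  qed
  have cif: "card (?if cond e) = of_bool cond" for cond and e :: "(real^2) set" by simp
  have card4: "card (A \<union> B \<union> C \<union> D) \<le> card A + card B + card C + card D" for A B C D :: "(real^2) set set"
    using card_Un_le[of "A \<union> B \<union> C" D] card_Un_le[of "A \<union> B" C] card_Un_le[of A B] by linarith
  have "finite ?U" by simp
  then have "card {e. e edge_of Q \<and> e edge_of P} \<le> card ?U" using shared by (rule card_mono)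
  also have "\<dots> \<le> of_bool (b = Suc a) + of_bool (c = Suc b) + of_bool (d = Suc c) + of_bool (a = 0 \<and> d = n - 1)"
    by (rule card4[THEN order_trans]) (simp only: cif order_refl)
  finally have three: "3 \<le> (of_bool (b = Suc a) + of_bool (c = Suc b) + of_bool (d = Suc c)
      + of_bool (a = 0 \<and> d = n - 1) :: nat)" using c3 by linarith
  have four: "{..<4} = {0, 1, 2, 3::nat}" by auto
  have m: "(i + r) mod n = (if i + r < n then i + r else i + r - n)" if "r < n" "i < 4" for i r
    using that n by (simp add: mod_if)
  \<comment> \<open>In each case the run starts just after the one pair not listed.\<close>
  consider "b = Suc a" "c = Suc b" "d = Suc c" | "c = Suc b" "d = Suc c" "a = 0" "d = n - 1"
    | "d = Suc c" "b = Suc a" "a = 0" "d = n - 1" | "b = Suc a" "c = Suc b" "a = 0" "d = n - 1"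
    using three by (auto simp: of_bool_def split: if_splits)
  then have "\<exists>r<n. (\<lambda>i. (i + r) mod n) ` {..<4} = A"
  proof cases
    case 1
    then show ?thesis using \<open>d < n\<close> by (intro exI[of _ a]) (auto simp: four m abcd(1))
  next
    case 2
    then show ?thesis using \<open>d < n\<close> n by (intro exI[of _ b]) (auto simp: four m abcd(1))
  next
    case 3
    then have nc: "n = c + 2" using n by linarith
    have "(0 + c) mod n = c" "(1 + c) mod n = d" "(2 + c) mod n = a" "(3 + c) mod n = b"
      using 3 n m[of c] by (simp_all only: nc) (simp_all add: mod_if)
    then show ?thesis using abcd(1) nc unfolding four by (intro exI[of _ c]) (auto simp only: image_insert image_empty)
  next
    case 4
    have nd: "n = d + 1" using 4 n by linarith
    have "(0 + d) mod n = d" "(1 + d) mod n = a" "(2 + d) mod n = b" "(3 + d) mod n = c"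
      using m[OF \<open>d < n\<close>, of 0] m[OF \<open>d < n\<close>, of 1] m[OF \<open>d < n\<close>, of 2] m[OF \<open>d < n\<close>, of 3]
        4(1-3) n unfolding nd by simp_all
    then show ?thesis using abcd(1) \<open>d < n\<close> unfolding four
      by (intro exI[of _ d]) (auto simp only: image_insert image_empty)
  qed
  then obtain r where "r < n" "(\<lambda>i. (i + r) mod n) ` {..<4} = A" by blast
  then have "(\<lambda>i. \<nu> ((i + r) mod n)) ` {..<4} = \<nu> ` A"
    by (metis image_image)
  then show ?thesis using that[OF \<open>r < n\<close>] A(2) by simp
qed

end

section \<open>Sign conditions from the position of the puncture\<close>

context punctured_labelling
begin

lemma rotate_punctured: "r < n \<Longrightarrow> punctured_labelling n (\<lambda>i. \<nu> ((i + r) mod n)) P p"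
  using rotate p by (simp add: punctured_labelling_def punctured_labelling_axioms_def)

lemma side_positive:
  assumes "p \<in> interior (convex hull (\<nu> ` W))" "W \<subseteq> {..<n}" "i < j" "j < n"
    and "\<And>k. k \<in> W \<Longrightarrow> k \<le> i \<or> j \<le> k"
  shows "\<sigma> i j > 0"
proof (rule orient_interior_pos)
  show "orient (\<nu> i) (\<nu> j) q \<ge> 0" if "q \<in> convex hull (\<nu> ` W)" for q
    using that by (rule orient_hull_nonneg[rotated]) (use assms orient_nonneg in blast)
qed (use assms vertex_less_neq in auto)

lemma edge_positive: "Suc i < n \<Longrightarrow> \<sigma> i (Suc i) > 0"
  using p hull by (intro side_positive[of "{..<n}"]) auto

text \<open>The signs of the boundary edges at 0 and the condition \<open>mono\<close> hold for
  every interior point; only chords avoiding 0 restrict its position.\<close>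

lemma central_labellingI:
  assumes "n \<ge> 4" "\<And>i j. 0 < i \<Longrightarrow> i < j \<Longrightarrow> j < n \<Longrightarrow> (i, j) \<noteq> (1, n - 1) \<Longrightarrow> \<sigma> i j > 0"
  shows "central_labelling n \<nu> P p"
proof -
  have "\<sigma> (n - 1) 0 > 0"
  proof (rule orient_interior_pos[OF _ p])
    show "orient (\<nu> (n - 1)) (\<nu> 0) q \<ge> 0" if "q \<in> P" for q
      using that unfolding hull
    proof (rule orient_hull_nonneg[rotated])
      fix v assume "v \<in> \<nu> ` {..<n}"
      then obtain k where k: "v = \<nu> k" "k < n" by auto
      show "orient (\<nu> (n - 1)) (\<nu> 0) v \<ge> 0"
      proof (cases "k = 0 \<or> k = n - 1")
        case False
        then have "orient (\<nu> 0) (\<nu> k) (\<nu> (n - 1)) > 0" using k n3 by (intro ccw) auto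
        then show ?thesis using k orient_rotate by (metis less_imp_le)
      qed (use k in auto)
    qed
    show "\<nu> (n - 1) \<noteq> \<nu> 0" using vertex_less_neq[of 0 "n - 1"] n3 by auto
  qed
  then have "\<sigma> 0 (n - 1) < 0" using orient_swap[of "\<nu> 0" "\<nu> (n - 1)" p] by simp
  moreover have "\<sigma> 0 1 > 0" using edge_positive[of 0] n3 by simp
  moreover have "\<sigma> 0 i > 0" if "0 < i" "i < j" "j < n" "\<sigma> 0 j \<ge> 0" for i j
    using wedge[of 0 i j] ccw[of 0 i j] that by simp
  ultimately have "central_puncture n (\<lambda>i j. \<sigma> i j)" using assms by unfold_locales auto
  then show ?thesis using punctured_labelling_axioms by (simp add: central_labelling_def)
qed

text \<open>A chord avoiding 0 and ending before n - 1 has the whole first quadrilateral on the side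
  of 0; a chord from \<open>i \<ge> 2\<close> to n - 1 has the second there. The ear chord splits
  both, as n - 2 and 2 lie behind it.\<close>

lemma central_labelling_between_quadrilaterals:
  assumes n: "n \<ge> 5" and 1: "p \<in> interior (convex hull (\<nu> ` {n - 2, n - 1, 0, 1}))"
    and 2: "p \<in> interior (convex hull (\<nu> ` {n - 1, 0, 1, 2}))"
  shows "central_labelling n \<nu> P p"
proof (rule central_labellingI)
  fix i j assume ij: "0 < i" "i < j" "j < n" "(i, j) \<noteq> (1, n - 1)"
  show "\<sigma> i j > 0"
  proof (cases "j = n - 1")
    case True
    then show ?thesis using ij n by (intro side_positive[OF 2]) auto
  next
    case False
    then show ?thesis using ij n by (intro side_positive[OF 1]) auto
  qed
qed (use n in simp)

end

text \<open>The chord from vertex 4 + r to vertex 1 + r (mod 5) cuts off the ear at vertex r. If the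
  puncture lies in some closed ear, the tip becomes vertex 0; otherwise it lies in the inner
  pentagon and the given numbering works.\<close>

lemma pentagon_central_labelling:
  assumes "punctured_labelling 5 \<nu> P p"
  obtains \<nu>' where "central_labelling 5 \<nu>' P p"
proof (cases "\<exists>r<5. orient (\<nu> ((4 + r) mod 5)) (\<nu> ((1 + r) mod 5)) p \<le> 0")
  case True
  then obtain r where r: "r < 5" "orient (\<nu> ((4 + r) mod 5)) (\<nu> ((1 + r) mod 5)) p \<le> 0" by blast
  let ?\<nu> = "\<lambda>i. \<nu> ((i + r) mod 5)"
  interpret L: punctured_labelling 5 ?\<nu> P p
    using punctured_labelling.rotate_punctured[OF assms r(1)] .
  have "L.\<sigma> 4 1 \<le> 0" using r(2) by simp
  have "L.\<sigma> 1 4 \<ge> 0" using r(2) orient_swap[of "?\<nu> 4" "?\<nu> 1" p] by simp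
  then have 13: "L.\<sigma> 1 3 > 0" using L.wedge[of 1 3 4] L.ccw[of 1 3 4] by simp
  have "orient (?\<nu> 4) (?\<nu> 1) (?\<nu> 2) > 0"
    using L.ccw[of 1 2 4] orient_rotate[of "?\<nu> 1" "?\<nu> 2" "?\<nu> 4"] by simp
  then have "L.\<sigma> 4 2 < 0" using L.wedge[of 4 1 2] \<open>L.\<sigma> 4 1 \<le> 0\<close> by force
  then have 24: "L.\<sigma> 2 4 > 0" using orient_swap[of "?\<nu> 4" "?\<nu> 2" p] by simp
  have "central_labelling 5 ?\<nu> P p"
  proof (rule L.central_labellingI)
    fix i j :: nat assume ij: "0 < i" "i < j" "j < 5" "(i, j) \<noteq> (1, 5 - 1)"
    then have "j = Suc i \<or> (i, j) = (1, 3) \<or> (i, j) = (2, 4)" by auto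
    then show "L.\<sigma> i j > 0" using 13 24 L.edge_positive[of i] ij by auto
  qed simp
  then show ?thesis by (rule that)
next
  case False
  interpret L: punctured_labelling 5 \<nu> P p by fact
  have "\<not> orient (\<nu> ((4 + r) mod 5)) (\<nu> ((1 + r) mod 5)) p \<le> 0" if "r < 5" for r using False that by blast
  \<comment> \<open>The ears at 2 and 3 are cut off by the chords (1, 3) and (2, 4).\<close>
  from this[of 2] this[of 3] have 13: "L.\<sigma> 1 3 > 0" and 24: "L.\<sigma> 2 4 > 0" by simp_all
  have "central_labelling 5 \<nu> P p"
  proof (rule L.central_labellingI)
    fix i j :: nat assume ij: "0 < i" "i < j" "j < 5" "(i, j) \<noteq> (1, 5 - 1)"
    then have "j = Suc i \<or> (i, j) = (1, 3) \<or> (i, j) = (2, 4)" by auto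
    then show "L.\<sigma> i j > 0" using 13 24 L.edge_positive[of i] ij by auto
  qed simp
  then show ?thesis by (rule that)
qed

text \<open>In a cycle of length 5 every nonzero shift of a run of four meets it in three places,
  whence the separate treatment of the pentagon; from length 6 on the overlap shrinks as soon as the
  shift exceeds one step.\<close>

lemma cyclic_shift_meeting_in_three:
  fixes n s :: nat
  assumes n: "n \<ge> 6" and s: "s < n" and c: "card ({..<4} \<inter> (\<lambda>i. (i + s) mod n) ` {..<4}) = 3"
  shows "s = 1 \<or> s = n - 1"
proof (rule ccontr)
  assume no: "\<not> ?thesis"
  let ?f = "\<lambda>i. (i + s) mod n"
  have four: "{..<4} = {0, 1, 2, 3::nat}" by auto
  show False
  proof (cases "s = 0")
    case True
    have "?f ` {..<4} = {..<4}" using True n by (auto simp: four)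
    then show False using c by simp
  next
    case False
    \<comment> \<open>Only the listed images can fall below 4. For a shift by 3 the image of 3 wraps
      to 0 if \<open>n = 6\<close>; for larger shifts, which are at most n - 2, only 2 and 3 can
      wrap.\<close>
    define U where "U = (if s = 2 then {?f 0, ?f 1} else if s = 3 then {?f 0, ?f 3} else {?f 2, ?f 3})"
    have "{..<4} \<inter> ?f ` {..<4} \<subseteq> U"
    proof
      fix x assume x: "x \<in> {..<4} \<inter> ?f ` {..<4}"
      then obtain i where i: "i < 4" "x = ?f i" "x < 4" by auto
      consider "i = 0" | "i = 1" | "i = 2" | "i = 3" using i(1) by linarith
      then show "x \<in> U"
        by cases (use i no False s n in \<open>auto simp: U_def mod_if split: if_splits\<close>)
    qed
    then have "card ({..<4} \<inter> ?f ` {..<4}) \<le> card U" by (intro card_mono) (simp add: U_def)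
    also have "card U \<le> 2" by (simp add: U_def card_insert_if)
    finally show False using c by simp
  qed
qed

lemma central_labelling_exists:
  assumes P: "convex_polygon n P"
    and Qm: "boundary_quadrilateral Q\<^sub>m P" and Qp: "boundary_quadrilateral Q\<^sub>p P"
    and c: "card (polygon_vertices Q\<^sub>m \<inter> polygon_vertices Q\<^sub>p) = 3"
    and p: "p \<in> interior (Q\<^sub>m \<inter> Q\<^sub>p)"
  obtains \<nu> where "central_labelling n \<nu> P p"
proof -
  have hull: "Q = convex hull polygon_vertices Q" if "boundary_quadrilateral Q P" for Q
    using that Krein_Milman_Minkowski polytope_imp_compact polytope_imp_convex
    unfolding boundary_quadrilateral_def convex_polygon_def polygon_vertices_def by blast
  have sub: "polygon_vertices Q \<subseteq> polygon_vertices P" "card (polygon_vertices Q) = 4"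
    if "boundary_quadrilateral Q P" for Q
    using that by (auto simp: boundary_quadrilateral_def convex_polygon_def)
  obtain \<nu>\<^sub>0 where L0: "polygon_labelling n \<nu>\<^sub>0 P" using convex_polygon_imp_labelling[OF P] .
  then interpret L0: polygon_labelling n \<nu>\<^sub>0 P .
  have finP: "finite (polygon_vertices P)" using L0.polygon_vertices_P by simp
  have "Q\<^sub>m \<subseteq> P"
  proof -
    have "polygon_vertices Q\<^sub>m \<subseteq> P" using sub(1)[OF Qm] by (auto simp: polygon_vertices_def extreme_point_of_def)
    then show ?thesis using hull[OF Qm] hull_minimal[of _ P convex] L0.convex_P by metis
  qed
  then have pP: "p \<in> interior P" using p interior_mono[of "Q\<^sub>m \<inter> Q\<^sub>p" P] by blast
  have pm: "p \<in> interior (convex hull polygon_vertices Q\<^sub>m)" and pp: "p \<in> interior (convex hull polygon_vertices Q\<^sub>p)"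
    using p hull[OF Qm] hull[OF Qp] by auto
  \<comment> \<open>With at most four vertices both quadrilaterals would use all of them and share
    four.\<close>
  have n5: "n \<ge> 5"
  proof (rule ccontr)
    assume "\<not> n \<ge> 5"
    then have "card (polygon_vertices P) \<le> 4" using P by (simp add: convex_polygon_def)
    then have "polygon_vertices Q\<^sub>m = polygon_vertices P" "polygon_vertices Q\<^sub>p = polygon_vertices P"
      using card_seteq[OF finP] sub[OF Qm] sub[OF Qp] by auto
    then show False using c sub(2)[OF Qm] by simp
  qed
  obtain r where r: "r < n" "polygon_vertices Q\<^sub>m = (\<lambda>i. \<nu>\<^sub>0 ((i + r) mod n)) ` {..<4}"
    using L0.boundary_quadrilateral_labels[OF n5 Qm] .
  define \<nu> where "\<nu> = (\<lambda>i. \<nu>\<^sub>0 ((i + r) mod n))"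
  interpret L: punctured_labelling n \<nu> P p
    using L0.rotate[OF r(1)] pP by (simp add: punctured_labelling_def punctured_labelling_axioms_def \<nu>_def)
  have Vm: "polygon_vertices Q\<^sub>m = \<nu> ` {..<4}" using r by (simp add: \<nu>_def)
  obtain s where s: "s < n" "polygon_vertices Q\<^sub>p = (\<lambda>i. \<nu> ((i + s) mod n)) ` {..<4}"
    using L.boundary_quadrilateral_labels[OF n5 Qp] .
  show ?thesis
  proof (cases "n = 5")
    case True
    then show ?thesis using pentagon_central_labelling that L.punctured_labelling_axioms by blast
  next
    case False
    then have n6: "n \<ge> 6" using n5 by simp
    have Vp: "polygon_vertices Q\<^sub>p = \<nu> ` (\<lambda>i. (i + s) mod n) ` {..<4}" using s by (simp add: image_image)
    have "polygon_vertices Q\<^sub>m \<inter> polygon_vertices Q\<^sub>p = \<nu> ` ({..<4} \<inter> (\<lambda>i. (i + s) mod n) ` {..<4})"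
      unfolding Vm Vp by (rule inj_on_image_Int[OF L.inj_on_vertices, symmetric]) (use n6 in auto)
    moreover have "inj_on \<nu> ({..<4} \<inter> (\<lambda>i. (i + s) mod n) ` {..<4})"
      by (rule inj_on_subset[OF L.inj_on_vertices]) (use n6 in auto)
    ultimately have "card ({..<4} \<inter> (\<lambda>i. (i + s) mod n) ` {..<4}) = 3" using c by (simp add: card_image)
    then have "s = 1 \<or> s = n - 1" using cyclic_shift_meeting_in_three[OF n6 s(1)] by blast
    moreover have four: "{..<4} = {0, 1, 2, 3::nat}" by auto
    ultimately consider "s = 1" | "s = n - 1" by blast
    then show ?thesis
    proof cases
      case 1
      \<comment> \<open>The runs are 0 to 3 and 1 to 4; the middle shared vertex is 2 and becomes
        vertex 0.\<close>
      let ?\<nu> = "\<lambda>i. \<nu> ((i + 2) mod n)"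
      interpret R: punctured_labelling n ?\<nu> P p using L.rotate_punctured[of 2] n6 by simp
      have "(n - 2 + 2) mod n = 0" "(n - 1 + 2) mod n = 1" "(0 + 2) mod n = 2" "(1 + 2) mod n = 3" "(2 + 2) mod n = 4"
        "(0 + 1) mod n = 1" "(1 + 1) mod n = 2" "(2 + 1) mod n = 3" "(3 + 1) mod n = 4"
        "0 mod n = 0" "1 mod n = 1" "2 mod n = 2" "3 mod n = 3"
        using n6 by (auto simp: mod_if)
      then have "?\<nu> ` {n - 2, n - 1, 0, 1} = polygon_vertices Q\<^sub>m" "?\<nu> ` {n - 1, 0, 1, 2} = polygon_vertices Q\<^sub>p"
        unfolding Vm s(2) four image_insert image_empty 1 by (simp_all only: insert_commute)
      then show ?thesis using that R.central_labelling_between_quadrilaterals n5 pm pp by metis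
    next
      case 2
      \<comment> \<open>The second run is n - 1, 0, 1, 2, so the middle shared vertex is 1.\<close>
      let ?\<nu> = "\<lambda>i. \<nu> ((i + 1) mod n)"
      interpret R: punctured_labelling n ?\<nu> P p using L.rotate_punctured[of 1] n6 by simp
      have "(n - 2 + 1) mod n = n - 1" "(n - 1 + 1) mod n = 0" "(0 + 1) mod n = 1" "(1 + 1) mod n = 2" "(2 + 1) mod n = 3"
        "(0 + (n - 1)) mod n = n - 1" "(1 + (n - 1)) mod n = 0" "(2 + (n - 1)) mod n = 1" "(3 + (n - 1)) mod n = 2"
        using n6 by (auto simp: mod_if)
      then have "?\<nu> ` {n - 2, n - 1, 0, 1} = polygon_vertices Q\<^sub>p" "?\<nu> ` {n - 1, 0, 1, 2} = polygon_vertices Q\<^sub>m"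
        unfolding Vm s(2) four image_insert image_empty 2 by (simp_all only: insert_commute)
      then show ?thesis using that R.central_labelling_between_quadrilaterals n5 pm pp by metis
    qed
  qed
qed

theorem theorem5p5:
  fixes P Q\<^sub>m Q\<^sub>p :: "(real^2) set" and p :: "real^2" and n :: nat
  assumes "convex_polygon n P"
    and "boundary_quadrilateral Q\<^sub>m P"
    and "boundary_quadrilateral Q\<^sub>p P"
    and "card (polygon_vertices Q\<^sub>m \<inter> polygon_vertices Q\<^sub>p) = 3"
    and "p \<in> interior (Q\<^sub>m \<inter> Q\<^sub>p)"
  shows "strongly_convex_embedding Inl
           (flip_graph (polygon_vertices P)) (extended_flip_graph P p)"
proof -
  obtain \<nu> where "central_labelling n \<nu> P p" using central_labelling_exists[OF assms] .
  then show ?thesis by (rule central_labelling.strongly_convex_extended_flip_graph)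
qed

end
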